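(* Let $\lambda$ be a partition of $N$, $M<N$, and let $\tau$ be a reverse standard tableau of shape $\lambda$ with property $R(M)$, so that $\tau{\downarrow_M}$ is a reverse standard tableau of some partition shape $\mu\vdash M$. Then for every $(v[1],\dots,v[M])\in\mathbb{N}^M$, $J_{[v[1],\dots,v[M],0,\dots,0],\tau}{\downarrow_M}=J_{[v[1],\dots,v[M]],\tau\downarrow_M}$, where the left side is computed for $(N,\lambda)$ and the right side for $(M,\mu)$.
   Context: Partitions in French convention (rows numbered bottom to top). For $n\ge1$ and $\nu\vdash n$: an RST of shape $\nu$ is a bijective filling with $1,\dots,n$ strictly decreasing along rows (left to right) and columns (bottom to top); $\mathrm{CT}_\tau[i]=c-r$ if $i$ is in column $c$, row $r$; $\tau_\nu$ fills the columns left to right, each bottom to top, with $n,\dots,1$. For $v\in\mathbb{N}^n$: $\sigma_v$ labels positions by $1,\dots,n$ in order of decreasing entries, ties left to right; $vs_i$ swaps entries $i,i+1$; $v\Psi=[v[2],\dots,v[n],v[1]+1]$. $\alpha$ indeterminate; $\zeta_{v,\tau}[i]=\alpha v[i]+\mathrm{CT}_\tau[\sigma_v[i]]$. Graph $G_\nu$: vertices pairs $(\tau,v)$ reachable from $(\tau_\nu,0^n)$ plus $\varnothing$; from $(\tau,v)$: edge $\Psi$ to $(\tau,v\Psi)$; edge $s_i$ to $(\tau,vs_i)$ if $v[i]<v[i+1]$; if $v[i]=v[i+1]$ and $\mathrm{CT}_\tau[\sigma_v[i]]-\mathrm{CT}_\tau[\sigma_v[i]+1]\ge2$, edge $s_i$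 to $(\tau',v)$, $\tau'$ obtained by interchanging $\sigma_v[i],\sigma_v[i]+1$; if $v[i]=v[i+1]$ and this interchange is not an RST, edge $s_i$ to $\varnothing$. $V_\nu$: $\mathbb{Q}(\alpha)$-space with basis the RSTs of shape $\nu$, right action: with $b=1/(\mathrm{CT}_\tau[i]-\mathrm{CT}_\tau[i+1])$, $\tau s_i=b\tau$ if $b=\pm1$; $b\tau+\tau^{(i,i+1)}$ if $0<b\le\frac12$; $b\tau+(1-b^2)\tau^{(i,i+1)}$ otherwise. $M_\nu=\mathbb{Q}(\alpha)[x_1,\dots,x_n]\otimes V_\nu$, operators on the right, $(f\otimes t)(\omega\otimes\omega)=(f\omega)\otimes(t\omega)$; $P\Psi=x_n\cdot(P(\theta\otimes\theta))$, $\theta=s_1\cdots s_{n-1}$. $J_{v,\tau}\in M_\nu$: $J_{0^n,\tau_\nu}=1\otimes\tau_\nu$; along edges from $(\tau,v)$: $s_i$-edge to $w$: $J_w=J_{v,\tau}\big(s_i\otimes s_i+\frac1{\zeta_{v,\tau}[i+1]-\zeta_{v,\tau}[i]}\big)$; $\Psi$-edge: $J_{v\Psi,\tau}=J_{v,\tau}\Psi$ (path-independent, defined for every RST $\tau$ and $v\in\mathbb{N}^n$). Restriction: for an RST $\rho$ of shape $\lambda$, $\rho{\downarrow_M}$ is the filling of a (possibly skew) diagram obtained by deleting the boxes containing $M+1,\dots,N$. $\tau$ has property $R(M)$ if $\tau{\downarrow_M}$ has the shape of a partition (then it is an RST of that shape). ${\downarrow_M}$ is the linear map from $M_\lambda$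 to the formal span over $\mathbb{Q}(\alpha)[x_1,\dots,x_M]$ of such fillings, sending $f\otimes\rho$ to $f(x_1,\dots,x_M,0,\dots,0)\otimes(\rho{\downarrow_M})$; $M_\mu$ is viewed inside this span. *)

theory Defs
  imports
    Complex_Main
    "HOL-Library.Poly_Mapping"
    "HOL-Computational_Algebra.Polynomial"
    "HOL-Computational_Algebra.Fraction_Field"
    "HOL-Combinatorics.Transposition"
begin

text \<open>Boxes are pairs \<open>(c, r)\<close> of a column and a row, both numbered from 1, the rows
  from bottom to top. A filling of a diagram is a partial function whose domain is the diagram.
  Vectors in \<open>\<nat>\<^sup>n\<close> are lists of length \<open>n\<close>.\<close>

type_synonym box = "nat \<times> nat"
type_synonym filling = "box \<Rightarrow> nat option"

definition is_partition :: "nat list \<Rightarrow> nat \<Rightarrow> bool" where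
  "is_partition \<nu> n \<longleftrightarrow> sorted_wrt (\<ge>) \<nu> \<and> 0 \<notin> set \<nu> \<and> sum_list \<nu> = n"

definition diagram :: "nat list \<Rightarrow> box set" where
  "diagram \<nu> = {(c, r). 1 \<le> r \<and> r \<le> length \<nu> \<and> 1 \<le> c \<and> c \<le> \<nu> ! (r - 1)}"

definition RST :: "nat list \<Rightarrow> filling \<Rightarrow> bool" where
  "RST \<nu> \<tau> \<longleftrightarrow>
     dom \<tau> = diagram \<nu> \<and>
     bij_betw (\<lambda>b. the (\<tau> b)) (diagram \<nu>) {1..sum_list \<nu>} \<and>
     (\<forall>c c' r. (c, r) \<in> diagram \<nu> \<and> (c', r) \<in> diagram \<nu> \<and> c < c' \<longrightarrow>
        the (\<tau> (c', r)) < the (\<tau> (c, r))) \<and>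
     (\<forall>c r r'. (c, r) \<in> diagram \<nu> \<and> (c, r') \<in> diagram \<nu> \<and> r < r' \<longrightarrow>
        the (\<tau> (c, r')) < the (\<tau> (c, r)))"

definition CT :: "filling \<Rightarrow> nat \<Rightarrow> int" where
  "CT \<tau> i = (case (THE b. \<tau> b = Some i) of (c, r) \<Rightarrow> int c - int r)"

definition root_tableau :: "nat list \<Rightarrow> filling" where
  "root_tableau \<nu> = (\<lambda>(c, r).
     if (c, r) \<in> diagram \<nu>
     then Some (sum_list \<nu> -
       card {(c', r'). (c', r') \<in> diagram \<nu> \<and> (c' < c \<or> c' = c \<and> r' < r)})
     else None)"

definition interchange :: "nat \<Rightarrow> filling \<Rightarrow> filling" where
  "interchange i \<tau> = (\<lambda>b. map_option (transpose i (i + 1)) (\<tau> b))"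

definition entry :: "nat list \<Rightarrow> nat \<Rightarrow> nat" where
  "entry v i = v ! (i - 1)"

definition sigma :: "nat list \<Rightarrow> nat \<Rightarrow> nat" where
  "sigma v i = card {j \<in> {1..length v}.
     entry v j > entry v i \<or> entry v j = entry v i \<and> j \<le> i}"

definition swap_vec :: "nat \<Rightarrow> nat list \<Rightarrow> nat list" where
  "swap_vec i v = v[i - 1 := entry v (i + 1), i := entry v i]"

definition psi_vec :: "nat list \<Rightarrow> nat list" where
  "psi_vec v = tl v @ [hd v + 1]"


text \<open>The field \<open>\<rat>(\<alpha>)\<close>, polynomials over it in variables indexed by \<open>nat\<close>
  (only \<open>x\<^sub>1, \<dots>, x\<^sub>n\<close> are used for partitions of \<open>n\<close>), and formal combinations
  of fillings: the space \<open>V\<^sub>\<nu>\<close> is the span of the RSTs of shape \<open>\<nu>\<close> in the type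
  \<open>vspace\<close>, and \<open>M\<^sub>\<nu>\<close> is their span over polynomials in the type \<open>pmodule\<close>,
  with \<open>f \<otimes> \<tau>\<close> represented by \<open>Poly_Mapping.single \<tau> f\<close>.\<close>

type_synonym ratfun = "rat poly fract"
type_synonym mpoly = "(nat \<Rightarrow>\<^sub>0 nat) \<Rightarrow>\<^sub>0 ratfun"
type_synonym vspace = "filling \<Rightarrow>\<^sub>0 ratfun"
type_synonym pmodule = "filling \<Rightarrow>\<^sub>0 mpoly"

definition alpha :: ratfun where
  "alpha = Fract [:0, 1:] 1"

definition Const :: "ratfun \<Rightarrow> mpoly" where
  "Const c = Poly_Mapping.single 0 c"

definition Var :: "nat \<Rightarrow> mpoly" where
  "Var k = Poly_Mapping.single (Poly_Mapping.single k 1) 1"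

definition subst :: "(nat \<Rightarrow> mpoly) \<Rightarrow> mpoly \<Rightarrow> mpoly" where
  "subst g f = (\<Sum>m\<in>Poly_Mapping.keys f.
     Const (Poly_Mapping.lookup f m) *
     (\<Prod>k\<in>Poly_Mapping.keys m. g k ^ Poly_Mapping.lookup m k))"

definition smul :: "mpoly \<Rightarrow> pmodule \<Rightarrow> pmodule" where
  "smul f P = Poly_Mapping.map (\<lambda>g. f * g) P"

definition tensor :: "mpoly \<Rightarrow> vspace \<Rightarrow> pmodule" where
  "tensor f t = (\<Sum>\<tau>\<in>Poly_Mapping.keys t.
     Poly_Mapping.single \<tau> (f * Const (Poly_Mapping.lookup t \<tau>)))"

definition s_tab :: "nat \<Rightarrow> filling \<Rightarrow> vspace" where
  "s_tab i \<tau> =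
     (let b = 1 / rat_of_int (CT \<tau> i - CT \<tau> (i + 1)) in
      if b = 1 \<or> b = - 1 then Poly_Mapping.single \<tau> (of_rat b)
      else if 0 < b \<and> b \<le> 1 / 2 then
        Poly_Mapping.single \<tau> (of_rat b) + Poly_Mapping.single (interchange i \<tau>) 1
      else
        Poly_Mapping.single \<tau> (of_rat b) +
        Poly_Mapping.single (interchange i \<tau>) (of_rat (1 - b\<^sup>2)))"

definition s_poly :: "nat \<Rightarrow> mpoly \<Rightarrow> mpoly" where
  "s_poly i f = subst (\<lambda>k. Var (transpose i (i + 1) k)) f"

text \<open>The operator \<open>s\<^sub>i \<otimes> s\<^sub>i\<close>.\<close>

definition s_op :: "nat \<Rightarrow> pmodule \<Rightarrow> pmodule" where
  "s_op i P = (\<Sum>\<tau>\<in>Poly_Mapping.keys P.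
     tensor (s_poly i (Poly_Mapping.lookup P \<tau>)) (s_tab i \<tau>))"

text \<open>Operators act on the right, so \<open>\<theta> = s\<^sub>1 \<cdots> s\<^sub>n\<^sub>-\<^sub>1\<close> applies \<open>s\<^sub>1\<close> first.\<close>

definition psi_op :: "nat \<Rightarrow> pmodule \<Rightarrow> pmodule" where
  "psi_op n P = smul (Var n) (fold s_op [1..<n] P)"

definition zeta :: "nat list \<Rightarrow> filling \<Rightarrow> nat \<Rightarrow> ratfun" where
  "zeta v \<tau> i = alpha * of_nat (entry v i) + of_int (CT \<tau> (sigma v i))"


text \<open>The vertex \<open>\<emptyset>\<close> of the graph \<open>G\<^sub>\<nu>\<close> is \<open>None\<close>. The relation \<open>edge\<close> does not
  itself require its source to be reachable from the root; \<open>jack_at\<close> only follows edges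
  along paths starting at the root.\<close>

type_synonym vertex = "(filling \<times> nat list) option"

datatype edge_label = Psi | S nat

inductive edge :: "nat list \<Rightarrow> vertex \<Rightarrow> edge_label \<Rightarrow> vertex \<Rightarrow> bool" for \<nu> where
  Psi_edge:
    "v \<noteq> [] \<Longrightarrow> edge \<nu> (Some (\<tau>, v)) Psi (Some (\<tau>, psi_vec v))"
| swap_edge:
    "1 \<le> i \<Longrightarrow> i < length v \<Longrightarrow> entry v i < entry v (i + 1) \<Longrightarrow>
     edge \<nu> (Some (\<tau>, v)) (S i) (Some (\<tau>, swap_vec i v))"
| tableau_edge:
    "1 \<le> i \<Longrightarrow> i < length v \<Longrightarrow> entry v i = entry v (i + 1) \<Longrightarrow>
     CT \<tau> (sigma v i) - CT \<tau> (sigma v i + 1) \<ge> 2 \<Longrightarrow>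
     edge \<nu> (Some (\<tau>, v)) (S i) (Some (interchange (sigma v i) \<tau>, v))"
| fall_edge:
    "1 \<le> i \<Longrightarrow> i < length v \<Longrightarrow> entry v i = entry v (i + 1) \<Longrightarrow>
     \<not> RST \<nu> (interchange (sigma v i) \<tau>) \<Longrightarrow>
     edge \<nu> (Some (\<tau>, v)) (S i) None"

text \<open>\<open>jack_at \<nu> w P\<close>: some path from the root of \<open>G\<^sub>\<nu>\<close> to \<open>w\<close> produces \<open>P\<close>.\<close>

inductive jack_at :: "nat list \<Rightarrow> vertex \<Rightarrow> pmodule \<Rightarrow> bool" for \<nu> where
  root:
    "jack_at \<nu> (Some (root_tableau \<nu>, replicate (sum_list \<nu>) 0))
       (Poly_Mapping.single (root_tableau \<nu>) 1)"
| Psi_step: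
    "jack_at \<nu> (Some (\<tau>, v)) P \<Longrightarrow> edge \<nu> (Some (\<tau>, v)) Psi w \<Longrightarrow>
     jack_at \<nu> w (psi_op (sum_list \<nu>) P)"
| S_step:
    "jack_at \<nu> (Some (\<tau>, v)) P \<Longrightarrow> edge \<nu> (Some (\<tau>, v)) (S i) w \<Longrightarrow>
     jack_at \<nu> w (s_op i P + smul (Const (1 / (zeta v \<tau> (i + 1) - zeta v \<tau> i))) P)"

definition J :: "nat list \<Rightarrow> nat list \<Rightarrow> filling \<Rightarrow> pmodule" where
  "J \<nu> v \<tau> = (THE P. jack_at \<nu> (Some (\<tau>, v)) P)"


definition delete_above :: "nat \<Rightarrow> filling \<Rightarrow> filling" where
  "delete_above M \<rho> = \<rho> |` {b. the (\<rho> b) \<le> M}"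

text \<open>The box \<open>(1, 1)\<close> of an RST carries the largest entry and is the first one to be deleted,
  so what remains is in general a translate of a diagram in standard position. Fillings of skew
  diagrams are therefore taken up to translation, by moving the lowest row and the leftmost
  column of the diagram to row 1 and column 1.\<close>

definition anchor :: "filling \<Rightarrow> filling" where
  "anchor \<rho> = (\<lambda>(c, r).
     \<rho> (c + Min (fst ` dom \<rho>) - 1, r + Min (snd ` dom \<rho>) - 1))"

definition restrict_tab :: "nat \<Rightarrow> filling \<Rightarrow> filling" where
  "restrict_tab M \<rho> = anchor (delete_above M \<rho>)"

definition property_R :: "nat \<Rightarrow> filling \<Rightarrow> bool" where
  "property_R M \<tau> \<longleftrightarrow> (\<exists>\<mu>. is_partition \<mu> M \<and> dom (restrict_tab M \<tau>) = diagram \<mu>)"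

definition restrict_poly :: "nat \<Rightarrow> mpoly \<Rightarrow> mpoly" where
  "restrict_poly M f = subst (\<lambda>k. if k \<le> M then Var k else 0) f"

definition restrict_mod :: "nat \<Rightarrow> pmodule \<Rightarrow> pmodule" where
  "restrict_mod M P = (\<Sum>\<rho>\<in>Poly_Mapping.keys P.
     Poly_Mapping.single (restrict_tab M \<rho>) (restrict_poly M (Poly_Mapping.lookup P \<rho>)))"

end

theory Submission
  imports Defs
begin

text \<open>
  A vertex of the graph is determined by its spectral vector, on which an \<open>s\<^sub>i\<close>-edge acts by a
  transposition and \<open>\<Psi>\<close> by a rotation that raises the moved entry. The graph is well-founded,
  and two edges into the same vertex always complete to a square or hexagon, on which the values
  agree by far commutation, the Yang-Baxter equation, \<open>s\<^sub>i\<^sub>+\<^sub>1 \<Psi> = \<Psi> s\<^sub>i\<close> or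
  \<open>s\<^sub>1 \<Psi>\<^sup>2 = \<Psi>\<^sup>2 s\<^sub>n\<^sub>-\<^sub>1\<close>. Hence every vertex carries exactly one value.

  A path in the graph of \<open>\<mu>\<close> lifts to the graph of \<open>\<lambda>\<close>: the \<open>s\<^sub>i\<close>-edges with \<open>i < M\<close> lift to
  themselves with the same coefficients, since removing boxes shifts all contents by a constant, and
  \<open>\<Psi>\<close> for \<open>M\<close> lifts to \<open>\<Psi> s\<^sub>N\<^sub>-\<^sub>1 \<cdots> s\<^sub>M\<close>, in which the scalar terms are divisible by one of
  \<open>x\<^sub>M\<^sub>+\<^sub>1, \<dots>, x\<^sub>N\<close> and disappear under restriction.
\<close>

subsection \<open>Finitely supported functions\<close>

text \<open>\<open>J\<close> is a definite description, so existence and uniqueness are settled on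
  the whole graph first; after that, the value at a lifted vertex may be read along whichever path
  imitates the smaller graph. The lift of the root of \<mu> is (\<rho>, 0^N), where \<rho> is some
  tableau restricting to the root tableau; it need not be the root for \<lambda>. The lifting can
  start there because the value is still 1 \<otimes> \<rho>. This rests on the normalisation of the
  action: when the content difference is at least 2, the interchanged tableau enters with
  coefficient 1. The braid and quadratic relations are derived on the span of the RSTs. Their
  coefficients are reciprocals of content differences, and in an RST the contents of i, i + 1, i + 2
  are pairwise distinct, because entries on one diagonal differ by at least 3. Squares and hexagons
  are closed by comparing spectral vectors, which suffices because an RST is determined by its
  contents.\<close>

lemma sum_keys_add:
  fixes G :: "'a \<Rightarrow> 'b::comm_monoid_add \<Rightarrow> 'c::comm_monoid_add"
  assumes "\<And>k. G k 0 = 0" "\<And>k a b. G k (a + b) = G k a + G k b"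
  shows "(\<Sum>k\<in>Poly_Mapping.keys (p + q). G k (Poly_Mapping.lookup (p + q) k)) =
    (\<Sum>k\<in>Poly_Mapping.keys p. G k (Poly_Mapping.lookup p k)) +
    (\<Sum>k\<in>Poly_Mapping.keys q. G k (Poly_Mapping.lookup q k))"
proof -
  \<comment> \<open>Cancellation can make the support of \<open>p + q\<close> smaller than the
    union, so all three sums are extended to the union; the added terms are
    \<open>G k 0\<close>.\<close>
  let ?S = "Poly_Mapping.keys p \<union> Poly_Mapping.keys q"
  have *: "(\<Sum>k\<in>Poly_Mapping.keys r. G k (Poly_Mapping.lookup r k)) =
      (\<Sum>k\<in>?S. G k (Poly_Mapping.lookup r k))" if "Poly_Mapping.keys r \<subseteq> ?S" for r
    using that by (intro sum.mono_neutral_left) (auto simp: in_keys_iff assms(1))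
  show ?thesis
    unfolding *[OF keys_add] *[OF Un_upper1] *[OF Un_upper2]
    by (simp add: lookup_add assms(2) sum.distrib)
qed

lemma sum_keys_single:
  assumes "G t 0 = 0"
  shows "(\<Sum>k\<in>Poly_Mapping.keys (Poly_Mapping.single t a).
    G k (Poly_Mapping.lookup (Poly_Mapping.single t a) k)) = G t a"
  using assms by (cases "a = 0") auto

lemma poly_mapping_add_induct [case_names single add]:
  fixes p :: "'a \<Rightarrow>\<^sub>0 'b::comm_monoid_add"
  assumes single: "\<And>k a. P (Poly_Mapping.single k a)"
    and add: "\<And>p q. P p \<Longrightarrow> P q \<Longrightarrow> P (p + q)"
  shows "P p"
proof (induction p rule: update_induct)
  case const
  show ?case using single[of undefined 0] by simp
next
  case (update f a b)
  have "Poly_Mapping.update a b f = f + Poly_Mapping.single a b"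
    using update(1)
    by (intro poly_mapping_eqI) (auto simp: lookup_update lookup_add lookup_single in_keys_iff)
  then show ?case using add[OF update(3) single] by simp
qed

text \<open>For relations that hold only on basis vectors satisfying \<open>Q\<close>, such as the
  RSTs. Zero is a separate case because no \<open>k\<close> need satisfy \<open>Q\<close>.\<close>

lemma span_induct [consumes 1, case_names zero single add]:
  fixes p :: "'a \<Rightarrow>\<^sub>0 'b::comm_monoid_add"
  assumes "\<And>k. k \<in> Poly_Mapping.keys p \<Longrightarrow> Q k"
    and zero: "P 0"
    and single: "\<And>k a. Q k \<Longrightarrow> P (Poly_Mapping.single k a)"
    and add: "\<And>p q. P p \<Longrightarrow> P q \<Longrightarrow> P (p + q)"
  shows "P p"
  using assms(1)
proof (induction p rule: update_induct)
  case const
  show ?case by (rule zero)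
next
  case (update f a b)
  have *: "Poly_Mapping.update a b f = f + Poly_Mapping.single a b"
    using update(1)
    by (intro poly_mapping_eqI) (auto simp: lookup_update lookup_add lookup_single in_keys_iff)
  have "Q a" "\<And>k. k \<in> Poly_Mapping.keys f \<Longrightarrow> Q k"
    using update by (auto simp: in_keys_iff lookup_update split: if_splits)
  then show ?case unfolding * using add single update(3) by blast
qed

subsection \<open>Substitution\<close>

definition mon_eval :: "(nat \<Rightarrow> mpoly) \<Rightarrow> (nat \<Rightarrow>\<^sub>0 nat) \<Rightarrow> mpoly" where
  "mon_eval g m = (\<Prod>k\<in>Poly_Mapping.keys m. g k ^ Poly_Mapping.lookup m k)"

lemma mon_eval_add: "mon_eval g (m + m') = mon_eval g m * mon_eval g m'"
proof -
  let ?S = "Poly_Mapping.keys m \<union> Poly_Mapping.keys m'"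
  have *: "mon_eval g r = (\<Prod>k\<in>?S. g k ^ Poly_Mapping.lookup r k)"
    if "Poly_Mapping.keys r \<subseteq> ?S" for r
    unfolding mon_eval_def using that
    by (intro prod.mono_neutral_left) (auto simp: in_keys_iff)
  have "Poly_Mapping.keys (m + m') \<subseteq> ?S" by (rule keys_add)
  then show ?thesis by (simp add: * lookup_add power_add prod.distrib)
qed

lemma Const_0 [simp]: "Const 0 = 0"
  and Const_1 [simp]: "Const 1 = 1"
  and Const_add: "Const (a + b) = Const a + Const b"
  and Const_uminus: "Const (- a) = - Const a"
  and Const_mult: "Const (a * b) = Const a * Const b"
  by (simp_all add: Const_def single_add single_uminus mult_single)

lemma subst_add: "subst g (f + h) = subst g f + subst g h"
  unfolding subst_def
  by (rule sum_keys_add) (simp_all add: Const_add algebra_simps)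

lemma subst_single: "subst g (Poly_Mapping.single m c) = Const c * mon_eval g m"
  unfolding subst_def mon_eval_def[symmetric] by (rule sum_keys_single) simp

lemma subst_0 [simp]: "subst g 0 = 0"
  by (simp add: subst_def)

lemma subst_Const [simp]: "subst g (Const c) = Const c"
  unfolding Const_def subst_single by (simp add: mon_eval_def Const_def)

lemma subst_1 [simp]: "subst g 1 = 1"
  using subst_Const[of g 1] by simp

lemma subst_Var [simp]: "subst g (Var k) = g k"
  unfolding Var_def subst_single by (simp add: mon_eval_def)

lemma subst_mult: "subst g (f * h) = subst g f * subst g h"
proof (induction f rule: poly_mapping_add_induct)
  case (single m a)
  show ?case
    by (induction h rule: poly_mapping_add_induct)
       (simp_all add: mult_single subst_single mon_eval_add Const_mult subst_add algebra_simps)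
qed (simp add: subst_add algebra_simps)

lemma subst_power: "subst g (f ^ n) = subst g f ^ n"
  by (induction n) (simp_all add: subst_mult)

lemma subst_prod: "subst g (\<Prod>k\<in>A. F k) = (\<Prod>k\<in>A. subst g (F k))"
  by (induction A rule: infinite_finite_induct) (simp_all add: subst_mult)

lemma subst_subst: "subst g (subst h f) = subst (\<lambda>k. subst g (h k)) f"
  by (induction f rule: poly_mapping_add_induct)
     (simp_all add: subst_single subst_add subst_mult mon_eval_def subst_prod subst_power)

lemma mon_eval_Var: "mon_eval Var m = Poly_Mapping.single m 1"
proof (induction m rule: poly_mapping_add_induct)
  case (single k a)
  have "Var k ^ a = Poly_Mapping.single (Poly_Mapping.single k a) 1"
    by (induction a) (simp_all add: Var_def mult_single flip: single_add)
  then show ?case by (auto simp: mon_eval_def)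
next
  case (add p q)
  then show ?case by (simp add: mon_eval_add mult_single)
qed

lemma subst_ident: "subst Var f = f"
  by (induction f rule: poly_mapping_add_induct)
     (simp_all add: subst_single subst_add mon_eval_Var Const_def mult_single)

lemma s_poly_add: "s_poly i (f + g) = s_poly i f + s_poly i g"
  and s_poly_mult: "s_poly i (f * g) = s_poly i f * s_poly i g"
  and s_poly_Const [simp]: "s_poly i (Const c) = Const c"
  and s_poly_0 [simp]: "s_poly i 0 = 0"
  and s_poly_1 [simp]: "s_poly i 1 = 1"
  and s_poly_Var [simp]: "s_poly i (Var k) = Var (transpose i (i + 1) k)"
  by (simp_all add: s_poly_def subst_add subst_mult)

lemma s_poly_involution [simp]: "s_poly i (s_poly i f) = f"
  by (simp add: s_poly_def subst_subst subst_ident)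

lemma s_poly_braid:
  "s_poly i (s_poly (Suc i) (s_poly i f)) = s_poly (Suc i) (s_poly i (s_poly (Suc i) f))"
  unfolding s_poly_def subst_subst subst_Var
  by (rule arg_cong[where f = "\<lambda>g. subst g f"]) (auto simp: transpose_def fun_eq_iff)

lemma s_poly_commute:
  assumes "i + 2 \<le> j \<or> j + 2 \<le> i"
  shows "s_poly i (s_poly j f) = s_poly j (s_poly i f)"
  unfolding s_poly_def subst_subst subst_Var
  using assms by (intro arg_cong[where f = "\<lambda>g. subst g f"]) (auto simp: transpose_def fun_eq_iff)

lemma restrict_poly_add: "restrict_poly M (f + g) = restrict_poly M f + restrict_poly M g"
  and restrict_poly_mult: "restrict_poly M (f * g) = restrict_poly M f * restrict_poly M g"
  and restrict_poly_Const [simp]: "restrict_poly M (Const c) = Const c"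
  and restrict_poly_0 [simp]: "restrict_poly M 0 = 0"
  and restrict_poly_1 [simp]: "restrict_poly M 1 = 1"
  and restrict_poly_Var: "restrict_poly M (Var k) = (if k \<le> M then Var k else 0)"
  by (simp_all add: restrict_poly_def subst_add subst_mult)

text \<open>Both i and i + 1 are at most M, so s_i does not mix the surviving variables with those
  set to zero.\<close>

lemma restrict_poly_s_poly:
  assumes "i < M"
  shows "restrict_poly M (s_poly i f) = s_poly i (restrict_poly M f)"
  unfolding s_poly_def restrict_poly_def subst_subst subst_Var
  using assms by (intro arg_cong[where f = "\<lambda>g. subst g f"]) (auto simp: transpose_def fun_eq_iff)

lemma restrict_poly_restrict_poly:
  assumes "M \<le> M'"
  shows "restrict_poly M (restrict_poly M' f) = restrict_poly M f"
  unfolding restrict_poly_def subst_subst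
  using assms by (intro arg_cong[where f = "\<lambda>g. subst g f"]) (auto simp: fun_eq_iff)

subsection \<open>Operators on the module\<close>

lemma lookup_smul [simp]: "Poly_Mapping.lookup (smul f P) \<tau> = f * Poly_Mapping.lookup P \<tau>"
  by (simp add: smul_def map.rep_eq when_def)

lemma smul_single [simp]: "smul f (Poly_Mapping.single \<tau> g) = Poly_Mapping.single \<tau> (f * g)"
  by (intro poly_mapping_eqI) (simp add: lookup_single when_def)

interpretation pmod: module smul
  by standard (auto intro!: poly_mapping_eqI simp: lookup_add algebra_simps)

definition axial :: "nat \<Rightarrow> filling \<Rightarrow> rat" where
  "axial i \<tau> = 1 / rat_of_int (CT \<tau> i - CT \<tau> (i + 1))"

text \<open>In the three cases of the action the coefficient of the interchanged tableau is a single
  function of the axial coefficient, because it vanishes at \<open>\<plusminus>1\<close>.\<close>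

definition off_coeff :: "rat \<Rightarrow> rat" where
  "off_coeff b = (if 0 < b \<and> b \<le> 1 / 2 then 1 else 1 - b\<^sup>2)"

lemma s_tab_eq: "s_tab i \<tau> = Poly_Mapping.single \<tau> (of_rat (axial i \<tau>)) +
    Poly_Mapping.single (interchange i \<tau>) (of_rat (off_coeff (axial i \<tau>)))"
  unfolding s_tab_def Let_def axial_def[symmetric] off_coeff_def
  by auto

lemma tensor_add_left: "tensor (f + g) t = tensor f t + tensor g t"
  by (simp add: tensor_def algebra_simps single_add sum.distrib)

lemma tensor_add_right: "tensor f (t + u) = tensor f t + tensor f u"
  unfolding tensor_def
  by (rule sum_keys_add) (simp_all add: Const_add algebra_simps single_add)

lemma tensor_single [simp]:
  "tensor f (Poly_Mapping.single \<tau> c) = Poly_Mapping.single \<tau> (f * Const c)"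
  unfolding tensor_def by (rule sum_keys_single) simp

lemma tensor_0_left [simp]: "tensor 0 t = 0"
  by (simp add: tensor_def)

lemma s_op_add: "s_op i (P + Q) = s_op i P + s_op i Q"
  unfolding s_op_def
  by (rule sum_keys_add) (simp_all add: s_poly_add tensor_add_left)

lemma s_op_single: "s_op i (Poly_Mapping.single \<tau> f) =
    Poly_Mapping.single \<tau> (Const (of_rat (axial i \<tau>)) * s_poly i f) +
    Poly_Mapping.single (interchange i \<tau>) (Const (of_rat (off_coeff (axial i \<tau>))) * s_poly i f)"
proof -
  have "s_op i (Poly_Mapping.single \<tau> f) = tensor (s_poly i f) (s_tab i \<tau>)"
    unfolding s_op_def by (rule sum_keys_single) simp
  then show ?thesis by (simp add: s_tab_eq tensor_add_right mult.commute)
qed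

lemma s_op_0 [simp]: "s_op i 0 = 0"
  by (simp add: s_op_def)

lemma s_op_smul: "s_op i (smul f P) = smul (s_poly i f) (s_op i P)"
  by (induction P rule: poly_mapping_add_induct)
     (simp_all add: s_op_single s_op_add s_poly_mult pmod.scale_right_distrib mult_ac)

lemma s_op_smul_Const [simp]: "s_op i (smul (Const c) P) = smul (Const c) (s_op i P)"
  by (simp add: s_op_smul)

lemma restrict_mod_add: "restrict_mod M (P + Q) = restrict_mod M P + restrict_mod M Q"
  unfolding restrict_mod_def
  by (rule sum_keys_add) (simp_all add: restrict_poly_add single_add)

lemma restrict_mod_single [simp]: "restrict_mod M (Poly_Mapping.single \<tau> f) =
    Poly_Mapping.single (restrict_tab M \<tau>) (restrict_poly M f)"
  unfolding restrict_mod_def by (rule sum_keys_single) simp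

lemma restrict_mod_0 [simp]: "restrict_mod M 0 = 0"
  by (simp add: restrict_mod_def)

lemma restrict_mod_smul: "restrict_mod M (smul f P) = smul (restrict_poly M f) (restrict_mod M P)"
  by (induction P rule: poly_mapping_add_induct)
     (simp_all add: restrict_mod_add restrict_poly_mult pmod.scale_right_distrib)

text \<open>The two definite descriptions have the same predicate, so this holds for every filling,
  even one that lacks the entry. The braid computation applies it to interchanges that may fail to
  be tableaux.\<close>

lemma CT_interchange [simp]: "CT (interchange i \<tau>) j = CT \<tau> (transpose i (i + 1) j)"
proof -
  have "(interchange i \<tau> b = Some j) = (\<tau> b = Some (transpose i (i + 1) j))" for b
    by (cases "\<tau> b") (auto simp: interchange_def)
  then show ?thesis by (simp add: CT_def)
qed

lemma interchange_involution [simp]: "interchange i (interchange i \<tau>) = \<tau>"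
  by (auto simp: interchange_def fun_eq_iff option.map_comp comp_def option.map_ident)

lemma interchange_braid: "interchange i (interchange (Suc i) (interchange i \<tau>)) =
    interchange (Suc i) (interchange i (interchange (Suc i) \<tau>))"
  unfolding interchange_def option.map_comp
  by (intro ext arg_cong[where f = "\<lambda>g. map_option g _"]) (auto simp: transpose_def fun_eq_iff)

lemma interchange_commute:
  assumes "i + 2 \<le> j \<or> j + 2 \<le> i"
  shows "interchange i (interchange j \<tau>) = interchange j (interchange i \<tau>)"
  unfolding interchange_def option.map_comp
  using assms
  by (intro ext arg_cong[where f = "\<lambda>g. map_option g _"]) (auto simp: transpose_def fun_eq_iff)

subsection \<open>Reverse standard tableaux\<close>

lemma diagram_downward_closed:
  assumes "is_partition \<nu> n" "(c, r) \<in> diagram \<nu>" "1 \<le> c'" "c' \<le> c" "1 \<le> r'" "r' \<le> r"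
  shows "(c', r') \<in> diagram \<nu>"
proof -
  have *: "sorted_wrt (\<ge>) \<nu>" using assms(1) by (simp add: is_partition_def)
  have "\<nu> ! (r - 1) \<le> \<nu> ! (r' - 1)"
  proof (cases "r' = r")
    case False
    then have "r' - 1 < r - 1" "r - 1 < length \<nu>"
      using assms by (auto simp: diagram_def)
    then show ?thesis using sorted_wrt_nth_less[OF *] by blast
  qed simp
  then show ?thesis using assms by (auto simp: diagram_def)
qed

locale tableau =
  fixes \<nu> :: "nat list" and n :: nat and \<tau> :: filling
  assumes part: "is_partition \<nu> n" and RST: "RST \<nu> \<tau>"
begin

lemma sum_shape: "sum_list \<nu> = n"
  using part by (simp add: is_partition_def)

lemma dom_tab: "dom \<tau> = diagram \<nu>"
  and bij: "bij_betw (\<lambda>b. the (\<tau> b)) (diagram \<nu>) {1..n}"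
  and row_decreasing: "(c, r) \<in> diagram \<nu> \<Longrightarrow> (c', r) \<in> diagram \<nu> \<Longrightarrow> c < c' \<Longrightarrow>
        the (\<tau> (c', r)) < the (\<tau> (c, r))"
  and col_decreasing: "(c, r) \<in> diagram \<nu> \<Longrightarrow> (c, r') \<in> diagram \<nu> \<Longrightarrow> r < r' \<Longrightarrow>
        the (\<tau> (c, r')) < the (\<tau> (c, r))"
  using RST unfolding RST_def sum_shape by metis+

lemma in_diagram: "\<tau> b = Some i \<Longrightarrow> b \<in> diagram \<nu>"
  using dom_tab by (metis domI)

lemma diagram_entry: "b \<in> diagram \<nu> \<Longrightarrow> \<exists>i. \<tau> b = Some i"
  using dom_tab by (metis domD)

lemma box_pos: "\<tau> (c, r) = Some i \<Longrightarrow> 1 \<le> c \<and> 1 \<le> r \<and> r \<le> length \<nu>"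
  using in_diagram[of "(c, r)" i] by (simp add: diagram_def)

lemma entry_range: "\<tau> b = Some i \<Longrightarrow> i \<in> {1..n}"
  using bij in_diagram[of b i] unfolding bij_betw_def by force

lemma box_unique: "\<tau> b = Some i \<Longrightarrow> \<tau> b' = Some i \<Longrightarrow> b = b'"
  using bij in_diagram[of b i] in_diagram[of b' i] unfolding bij_betw_def inj_on_def by force

lemma box_exists:
  assumes "i \<in> {1..n}"
  obtains c r where "\<tau> (c, r) = Some i"
proof -
  have "i \<in> (\<lambda>b. the (\<tau> b)) ` diagram \<nu>" using bij assms by (simp add: bij_betw_def)
  then obtain b where b: "b \<in> diagram \<nu>" "the (\<tau> b) = i" by blast
  then have "\<tau> (fst b, snd b) = Some i" using diagram_entry[OF b(1)] by auto
  then show thesis by (rule that)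
qed

lemma CT_box: "\<tau> (c, r) = Some i \<Longrightarrow> CT \<tau> i = int c - int r"
proof -
  assume *: "\<tau> (c, r) = Some i"
  have "(THE b. \<tau> b = Some i) = (c, r)"
  proof (rule the_equality)
    show "b = (c, r)" if "\<tau> b = Some i" for b using box_unique[OF that *] .
  qed (rule *)
  then show ?thesis by (simp add: CT_def)
qed

lemma box_between:
  assumes "\<tau> (c, r) = Some i" "1 \<le> c'" "c' \<le> c" "1 \<le> r'" "r' \<le> r"
  obtains j where "\<tau> (c', r') = Some j"
proof -
  have "(c', r') \<in> diagram \<nu>"
    using diagram_downward_closed[OF part in_diagram] assms by blast
  then show thesis using diagram_entry that by blast
qed

lemma row_less: "\<tau> (c, r) = Some i \<Longrightarrow> \<tau> (c', r) = Some i' \<Longrightarrow> c < c' \<Longrightarrow> i' < i"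
  using row_decreasing[OF in_diagram in_diagram, of c r i c' i'] by simp

lemma col_less: "\<tau> (c, r) = Some i \<Longrightarrow> \<tau> (c, r') = Some i' \<Longrightarrow> r < r' \<Longrightarrow> i' < i"
  using col_decreasing[OF in_diagram in_diagram, of c r i r' i'] by simp

lemma entry_less:
  assumes "\<tau> (c, r) = Some i" "\<tau> (c', r') = Some i'" "c \<le> c'" "r \<le> r'" "(c, r) \<noteq> (c', r')"
  shows "i' < i"
proof -
  have "1 \<le> c" "1 \<le> r" using box_pos[OF assms(1)] by auto
  then obtain j where j: "\<tau> (c', r) = Some j"
    using box_between[OF assms(2), of c' r] assms by auto
  have "j \<le> i" using row_less[OF assms(1) j] assms(1,3) j by (cases "c = c'") auto
  moreover have "i' \<le> j" using col_less[OF j assms(2)] assms(2,4) j by (cases "r = r'") auto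
  moreover have "j < i \<or> i' < j"
    using row_less[OF assms(1) j] col_less[OF j assms(2)] assms by (cases "c = c'") auto
  ultimately show ?thesis by auto
qed

text \<open>The two other corners of the rectangle lie in the diagram and carry two distinct entries
  strictly between i' and i.\<close>

lemma entry_diagonal:
  assumes "\<tau> (c, r) = Some i" "\<tau> (c', r') = Some i'" "c < c'" "r < r'"
  shows "i' + 3 \<le> i"
proof -
  have "1 \<le> c" "1 \<le> r" using box_pos[OF assms(1)] by auto
  then obtain j k where j: "\<tau> (c', r) = Some j" and k: "\<tau> (c, r') = Some k"
    using box_between[OF assms(2)] assms by (metis less_imp_le_nat order_refl le_trans)
  have "j \<noteq> k" using box_unique[OF j] k assms by auto
  moreover have "j < i" "k < i" "i' < j" "i' < k"
    using row_less[OF assms(1) j] col_less[OF assms(1) k] row_less[OF k assms(2)]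
      col_less[OF j assms(2)] assms by auto
  ultimately show ?thesis by linarith
qed

text \<open>Equal contents mean a common diagonal, where entries differ by at least 3. Distance 2 is
  included for the third denominator of the braid relation.\<close>

lemma CT_neq_near:
  assumes "1 \<le> i" "i < j" "j \<le> i + 2" "j \<le> n"
  shows "CT \<tau> i \<noteq> CT \<tau> j"
proof
  assume eq: "CT \<tau> i = CT \<tau> j"
  obtain c r where 1: "\<tau> (c, r) = Some i" using box_exists[of i] assms by auto
  obtain c' r' where 2: "\<tau> (c', r') = Some j" using box_exists[of j] assms by auto
  have *: "int c - int r = int c' - int r'" using eq CT_box[OF 1] CT_box[OF 2] by simp
  have "(c, r) \<noteq> (c', r')" using 1 2 assms by auto
  then have "c < c' \<and> r < r' \<or> c' < c \<and> r' < r" using * by auto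
  then show False using entry_diagonal[OF 1 2] entry_diagonal[OF 2 1] assms by linarith
qed

lemma row_neighbours:
  assumes "\<tau> (c, r) = Some (Suc i)" "\<tau> (c', r) = Some i" "c < c'"
  shows "c' = Suc c"
proof (rule ccontr)
  assume "c' \<noteq> Suc c"
  then obtain j where j: "\<tau> (Suc c, r) = Some j"
    using box_between[OF assms(2), of "Suc c" r] assms box_pos[OF assms(1)] by auto
  show False using row_less[OF assms(1) j] row_less[OF j assms(2)] assms \<open>c' \<noteq> Suc c\<close> by auto
qed

lemma col_neighbours:
  assumes "\<tau> (c, r) = Some (Suc i)" "\<tau> (c, r') = Some i" "r < r'"
  shows "r' = Suc r"
proof (rule ccontr)
  assume "r' \<noteq> Suc r"
  then obtain j where j: "\<tau> (c, Suc r) = Some j"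
    using box_between[OF assms(2), of c "Suc r"] assms box_pos[OF assms(1)] by auto
  show False using col_less[OF assms(1) j] col_less[OF j assms(2)] assms \<open>r' \<noteq> Suc r\<close> by auto
qed

text \<open>The transposition reverses the order of i and i + 1 only. If these shared a row or a
  column they would be neighbours there, with contents differing by 1.\<close>

lemma interchange_RST:
  assumes "1 \<le> i" "i < n" "2 \<le> \<bar>CT \<tau> i - CT \<tau> (i + 1)\<bar>"
  shows "RST \<nu> (interchange i \<tau>)"
proof -
  let ?t = "transpose i (i + 1)"
  have the: "the (interchange i \<tau> b) = ?t (the (\<tau> b))" if "b \<in> diagram \<nu>" for b
    using diagram_entry[OF that] by (auto simp: interchange_def)
  have "bij_betw (?t \<circ> (\<lambda>b. the (\<tau> b))) (diagram \<nu>) {1..n}"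
    using assms by (intro bij_betw_trans[OF bij] bij_betw_transpose_iff) auto
  then have bij': "bij_betw (\<lambda>b. the (interchange i \<tau> b)) (diagram \<nu>) {1..n}"
    by (rule bij_betw_cong[THEN iffD1, rotated]) (simp add: the)
  have mono: "?t k < ?t j" if "k < j" "\<not> (k = i \<and> j = Suc i)" for j k
    using that by (auto simp: transpose_def)
  have row: "the (interchange i \<tau> (c', r)) < the (interchange i \<tau> (c, r))"
    if b: "(c, r) \<in> diagram \<nu>" "(c', r) \<in> diagram \<nu>" "c < c'" for c c' r
  proof -
    obtain j k where jk: "\<tau> (c, r) = Some j" "\<tau> (c', r) = Some k"
      using b diagram_entry by blast
    have "\<not> (k = i \<and> j = Suc i)"
      using row_neighbours[of c r i c'] CT_box[OF jk(1)] CT_box[OF jk(2)] jk b assms by auto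
    then show ?thesis using the[OF b(1)] the[OF b(2)] mono row_decreasing[OF b] jk by simp
  qed
  have col: "the (interchange i \<tau> (c, r')) < the (interchange i \<tau> (c, r))"
    if b: "(c, r) \<in> diagram \<nu>" "(c, r') \<in> diagram \<nu>" "r < r'" for c r r'
  proof -
    obtain j k where jk: "\<tau> (c, r) = Some j" "\<tau> (c, r') = Some k"
      using b diagram_entry by blast
    have "\<not> (k = i \<and> j = Suc i)"
      using col_neighbours[of c r i r'] CT_box[OF jk(1)] CT_box[OF jk(2)] jk b assms by auto
    then show ?thesis using the[OF b(1)] the[OF b(2)] mono col_decreasing[OF b] jk by simp
  qed
  have "dom (interchange i \<tau>) = diagram \<nu>"
    using dom_tab by (auto simp: interchange_def dom_def)
  then show ?thesis unfolding RST_def sum_shape using bij' row col by blast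
qed

end

section \<open>A statistic on tableaux that is least at the root tableau\<close>

definition tab_measure :: "nat list \<Rightarrow> nat \<Rightarrow> filling \<Rightarrow> nat" where
  "tab_measure \<nu> n \<tau> = nat (\<Sum>j\<in>{1..n}. int j * (CT \<tau> j + int (length \<nu>)))"

text \<open>The larger weight i + 1 receives the larger content, so the weighted sum grows by the
  content difference. The shift by \<open>length \<nu>\<close> makes all contents nonnegative, so
  that \<open>nat\<close> truncates nothing.\<close>

lemma (in tableau) tab_measure_interchange:
  assumes "1 \<le> i" "i < n" "2 \<le> CT \<tau> i - CT \<tau> (i + 1)"
  shows "tab_measure \<nu> n \<tau> < tab_measure \<nu> n (interchange i \<tau>)"
proof -
  define f where "f j = CT \<tau> j + int (length \<nu>)" for j
  let ?t = "transpose i (i + 1)"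
  have nonneg: "0 \<le> f j" if j: "j \<in> {1..n}" for j
  proof -
    obtain c r where *: "\<tau> (c, r) = Some j" using box_exists[OF j] by blast
    show ?thesis using CT_box[OF *] box_pos[OF *] by (simp add: f_def)
  qed
  have "(\<Sum>j\<in>{1..n}. int j * f (?t j)) = (\<Sum>j\<in>{1..n}. int (?t j) * f (?t (?t j)))"
    using assms by (intro sum.reindex_bij_betw[symmetric] bij_betw_transpose_iff) auto
  then have "(\<Sum>j\<in>{1..n}. int j * f (?t j)) - (\<Sum>j\<in>{1..n}. int j * f j) =
      (\<Sum>j\<in>{1..n}. (int (?t j) - int j) * f j)"
    by (simp add: sum_subtractf algebra_simps)
  also have "\<dots> = (\<Sum>j\<in>{i, i + 1}. (int (?t j) - int j) * f j)"
    using assms by (intro sum.mono_neutral_right) auto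
  also have "\<dots> = f i - f (i + 1)" by (simp add: algebra_simps)
  also have "\<dots> > 0" using assms by (simp add: f_def)
  finally have "(\<Sum>j\<in>{1..n}. int j * f j) < (\<Sum>j\<in>{1..n}. int j * f (?t j))" by simp
  moreover have "0 \<le> (\<Sum>j\<in>{1..n}. int j * f j)" by (intro sum_nonneg mult_nonneg_nonneg nonneg) auto
  ultimately show ?thesis by (simp add: tab_measure_def f_def)
qed

text \<open>The hypothesis excludes every interchange that would lower \<open>tab_measure\<close>.
  Then the box of i + 1 precedes the box of i in column order: a box further right would also have
  to lie lower, and its content would be larger by at least 2. Hence the entry of a box is n minus
  the number of boxes before it.\<close>

lemma (in tableau) eq_root_tableau:
  assumes "\<And>i. 1 \<le> i \<Longrightarrow> i < n \<Longrightarrow> \<not> CT \<tau> i - CT \<tau> (i + 1) \<le> - 2"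
  shows "\<tau> = root_tableau \<nu>"
proof -
  have step: "c' < c \<or> c' = c \<and> r' < r"
    if b: "\<tau> (c, r) = Some i" "\<tau> (c', r') = Some (Suc i)" for c r c' r' i
  proof -
    have "1 \<le> i" "i < n" using entry_range[OF b(1)] entry_range[OF b(2)] by auto
    then have "\<not> CT \<tau> i - CT \<tau> (i + 1) \<le> - 2" using assms by blast
    then have ct: "\<not> (int c - int r) - (int c' - int r') \<le> - 2"
      using CT_box[OF b(1)] CT_box[OF b(2)] by simp
    have "(c, r) \<noteq> (c', r')" using b by auto
    then have "\<not> (c \<le> c' \<and> r \<le> r')" using entry_less[OF b] by auto
    then show ?thesis using ct by linarith
  qed
  have before: "c' < c \<or> c' = c \<and> r' < r"
    if "i < j" "\<tau> (c, r) = Some i" "\<tau> (c', r') = Some j" for i j c r c' r'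
    using that
  proof (induction j arbitrary: c' r')
    case (Suc j)
    show ?case
    proof (cases "i = j")
      case True
      then show ?thesis using Suc step by blast
    next
      case False
      then have "i < j" using Suc by simp
      moreover have "j \<in> {1..n}"
        using \<open>i < j\<close> entry_range[OF Suc.prems(3)] by auto
      then obtain c2 r2 where *: "\<tau> (c2, r2) = Some j" using box_exists by blast
      ultimately show ?thesis using Suc.IH[OF _ Suc.prems(2) *] step[OF * Suc.prems(3)] by auto
    qed
  qed simp
  have "\<tau> (c, r) = root_tableau \<nu> (c, r)" for c r
  proof (cases "\<tau> (c, r)")
    case None
    then show ?thesis using diagram_entry[of "(c, r)"] by (auto simp: root_tableau_def)
  next
    case (Some i)
    let ?A = "{(c', r'). (c', r') \<in> diagram \<nu> \<and> (c' < c \<or> c' = c \<and> r' < r)}"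
    have in_A: "b \<in> ?A \<longleftrightarrow> (\<exists>j. \<tau> b = Some j \<and> i < j)" for b
    proof (cases "\<tau> b")
      case None
      then show ?thesis using diagram_entry[of b] by auto
    next
      case (Some j)
      obtain c' r' where b: "b = (c', r')" by (cases b)
      have "b \<in> diagram \<nu>" using Some by (rule in_diagram)
      moreover have "i = j \<Longrightarrow> b = (c, r)"
        using box_unique[OF Some] \<open>\<tau> (c, r) = Some i\<close> by simp
      ultimately show ?thesis
        using before[of i j c r c' r'] before[of j i c' r' c r] Some \<open>\<tau> (c, r) = Some i\<close> b
        by (cases i j rule: linorder_cases) auto
    qed
    have "bij_betw (\<lambda>b. the (\<tau> b)) ?A {i+1..n}"
      unfolding bij_betw_def
    proof
      show "inj_on (\<lambda>b. the (\<tau> b)) ?A"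
        using bij by (auto simp: bij_betw_def inj_on_def)
      show "(\<lambda>b. the (\<tau> b)) ` ?A = {i+1..n}"
      proof (intro equalityI subsetI)
        fix j assume "j \<in> (\<lambda>b. the (\<tau> b)) ` ?A"
        then obtain b where "b \<in> ?A" "j = the (\<tau> b)" by blast
        then show "j \<in> {i+1..n}" using in_A[of b] entry_range[of b] by fastforce
      next
        fix j assume j: "j \<in> {i+1..n}"
        then obtain c' r' where *: "\<tau> (c', r') = Some j" using box_exists[of j] by auto
        then have "(c', r') \<in> ?A" using in_A[of "(c', r')"] j by auto
        then show "j \<in> (\<lambda>b. the (\<tau> b)) ` ?A" using * by (intro image_eqI[of _ _ "(c', r')"]) auto
      qed
    qed
    then have "card ?A = n - i" by (simp add: bij_betw_same_card)
    moreover have "(c, r) \<in> diagram \<nu>" using Some by (rule in_diagram)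
    moreover have "i \<le> n" using entry_range[OF Some] by simp
    ultimately show ?thesis using Some by (simp add: root_tableau_def sum_shape)
  qed
  then show ?thesis by auto
qed

text \<open>An RST minimising \<open>tab_measure\<close> admits no lowering interchange, so it is
  the root tableau. This yields at once that the closed formula defines an RST and that it is
  minimal.\<close>

lemma root_tableau_minimal:
  assumes part: "is_partition \<nu> n" and "RST \<nu> \<tau>"
  shows "RST \<nu> (root_tableau \<nu>)"
    and "tab_measure \<nu> n (root_tableau \<nu>) \<le> tab_measure \<nu> n \<tau>"
proof -
  define \<rho> where "\<rho> = (ARG_MIN (tab_measure \<nu> n) \<rho>. RST \<nu> \<rho>)"
  have \<rho>: "RST \<nu> \<rho>" and min: "\<And>\<rho>'. RST \<nu> \<rho>' \<Longrightarrow> tab_measure \<nu> n \<rho> \<le> tab_measure \<nu> n \<rho>'"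
    using arg_min_nat_lemma[of "RST \<nu>" \<tau>] assms by (auto simp: \<rho>_def)
  interpret tableau \<nu> n \<rho> using part \<rho> by unfold_locales
  have "\<not> CT \<rho> i - CT \<rho> (i + 1) \<le> - 2" if "1 \<le> i" "i < n" for i
  proof
    assume *: "CT \<rho> i - CT \<rho> (i + 1) \<le> - 2"
    then have "RST \<nu> (interchange i \<rho>)" by (intro interchange_RST that) auto
    then interpret i: tableau \<nu> n "interchange i \<rho>" using part by unfold_locales
    have "tab_measure \<nu> n (interchange i \<rho>) < tab_measure \<nu> n \<rho>"
      using i.tab_measure_interchange[OF that] * by simp
    then show False using min[OF i.RST] by simp
  qed
  then have "\<rho> = root_tableau \<nu>" by (rule eq_root_tableau)
  then show "RST \<nu> (root_tableau \<nu>)" "tab_measure \<nu> n (root_tableau \<nu>) \<le> tab_measure \<nu> n \<tau>"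
    using \<rho> min assms by auto
qed

text \<open>Compare the boxes of j from the largest entry downwards. If they differ, they lie on one
  diagonal; in the lower left one of them the other tableau has an entry k > j, and by induction
  both tableaux have k there, a contradiction.\<close>

lemma RST_eq_if_CT_eq:
  assumes part: "is_partition \<nu> n" and R: "RST \<nu> \<tau>" "RST \<nu> \<tau>'"
    and CT: "\<And>i. i \<in> {1..n} \<Longrightarrow> CT \<tau> i = CT \<tau>' i"
  shows "\<tau> = \<tau>'"
proof -
  interpret t: tableau \<nu> n \<tau> using part R by unfold_locales
  interpret t': tableau \<nu> n \<tau>' using part R by unfold_locales
  have same: "b = b'" if "\<tau> b = Some j" "\<tau>' b' = Some j" for j b b'
    using that
  proof (induction "n - j" arbitrary: j b b' rule: less_induct)
    case less
    obtain c r where b1: "b = (c, r)" by (cases b)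
    obtain c' r' where b2: "b' = (c', r')" by (cases b')
    note b = b1 b2
    have j: "j \<in> {1..n}" using t.entry_range less by blast
    have eq: "int c - int r = int c' - int r'"
      using t.CT_box t'.CT_box less.prems CT[OF j] b by metis
    show ?case
    proof (rule ccontr)
      assume "b \<noteq> b'"
      then consider "c < c'" "r < r'" | "c' < c" "r' < r" using eq b by fastforce
      then show False
      proof cases
        case 1
        then obtain k where k: "\<tau>' (c, r) = Some k"
          using t'.box_between[of c' r' j c r] t.box_pos[of c r j] less.prems b by auto
        then have "j < k" using t'.entry_diagonal[OF k, of c' r' j] 1 less.prems b by auto
        moreover have kn: "k \<in> {1..n}" using t'.entry_range k by blast
        moreover obtain c2 r2 where k2: "\<tau> (c2, r2) = Some k" using t.box_exists[OF kn] by blast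
        ultimately have "(c2, r2) = (c, r)" using less.hyps[OF _ k2 k] by auto
        then show False using k2 less.prems b \<open>j < k\<close> by simp
      next
        case 2
        then obtain k where k: "\<tau> (c', r') = Some k"
          using t.box_between[of c r j c' r'] t'.box_pos[of c' r' j] less.prems b by auto
        then have "j < k" using t.entry_diagonal[OF k, of c r j] 2 less.prems b by auto
        moreover have kn: "k \<in> {1..n}" using t.entry_range k by blast
        moreover obtain c2 r2 where k2: "\<tau>' (c2, r2) = Some k" using t'.box_exists[OF kn] by blast
        ultimately have "(c', r') = (c2, r2)" using less.hyps[OF _ k k2] by auto
        then show False using k2 less.prems b \<open>j < k\<close> by simp
      qed
    qed
  qed
  have "\<tau> b = \<tau>' b" for b
  proof (cases "\<tau> b")
    case None
    then show ?thesis using t.dom_tab t'.dom_tab by (metis domIff)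
  next
    case (Some j)
    then have "j \<in> {1..n}" using t.entry_range by blast
    then obtain c r where "\<tau>' (c, r) = Some j" using t'.box_exists by blast
    then show ?thesis using same[OF Some] Some by auto
  qed
  then show ?thesis by auto
qed

subsection \<open>Restriction of tableaux\<close>

text \<open>Both i and i + 1 survive, so the same boxes are deleted, and the shift made by
  \<open>anchor\<close> depends only on the set of remaining boxes.\<close>

lemma restrict_tab_interchange:
  assumes "i < M"
  shows "restrict_tab M (interchange i \<tau>) = interchange i (restrict_tab M \<tau>)"
proof -
  have *: "(transpose i (i + 1) k \<le> M) = (k \<le> M)" for k
    using assms by (auto simp: transpose_def)
  have "delete_above M (interchange i \<tau>) b = interchange i (delete_above M \<tau>) b" for b
    by (cases "\<tau> b") (use * in \<open>simp_all add: delete_above_def interchange_def restrict_map_def\<close>)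
  then have del: "delete_above M (interchange i \<tau>) = interchange i (delete_above M \<tau>)" by auto
  have dom: "dom (interchange i \<rho>) = dom \<rho>" for \<rho>
    by (auto simp: interchange_def)
  show ?thesis unfolding restrict_tab_def del anchor_def dom by (auto simp: interchange_def)
qed

text \<open>Coordinates are natural numbers, so the second clause is what guarantees that every
  surviving box is reached by the translation.\<close>

lemma (in tableau) restrict_tab_translate:
  assumes "M \<le> n"
  shows "\<exists>c0 r0.
    (\<forall>c r j. restrict_tab M \<tau> (c, r) = Some j \<longleftrightarrow> \<tau> (c + c0, r + r0) = Some j \<and> j \<le> M) \<and>
    (\<forall>c r j. \<tau> (c, r) = Some j \<longrightarrow> j \<le> M \<longrightarrow> (\<exists>c' r'. c = c' + c0 \<and> r = r' + r0))"
proof -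
  let ?D = "dom (delete_above M \<tau>)"
  define c1 r1 where "c1 = Min (fst ` ?D)" and "r1 = Min (snd ` ?D)"
  have del: "delete_above M \<tau> b = Some j \<longleftrightarrow> \<tau> b = Some j \<and> j \<le> M" for b j
    by (auto simp: delete_above_def restrict_map_def)
  have eq: "restrict_tab M \<tau> (c, r) = delete_above M \<tau> (c + c1 - 1, r + r1 - 1)" for c r
    by (simp add: restrict_tab_def anchor_def c1_def r1_def)
  show ?thesis
  proof (cases "?D = {}")
    \<comment> \<open>With no surviving box, \<open>Min\<close> is taken of an empty set and the
      shift is unspecified. Both sides of the first clause are then false and the second clause is
      vacuous.\<close>
    case True
    then have no: "\<not> (\<tau> b = Some j \<and> j \<le> M)" for b j using del[of b j] by auto
    show ?thesis
      unfolding eq del using no by blast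
  next
    case False
    have "?D \<subseteq> dom \<tau>" by (auto simp: delete_above_def restrict_map_def dom_def)
    moreover have "finite (dom \<tau>)"
      using bij dom_tab bij_betw_finite by (metis finite_atLeastAtMost)
    ultimately have fin: "finite ?D" by (rule finite_subset)
    have "c1 \<in> fst ` ?D" "r1 \<in> snd ` ?D"
      unfolding c1_def r1_def using fin False by (intro Min_in; simp)+
    then have pos: "1 \<le> c1" "1 \<le> r1"
      using \<open>?D \<subseteq> dom \<tau>\<close> box_pos by force+
    have ge: "c1 \<le> c \<and> r1 \<le> r" if "\<tau> (c, r) = Some j" "j \<le> M" for c r j
    proof -
      have "(c, r) \<in> ?D" using that del by blast
      then show ?thesis
        unfolding c1_def r1_def using fin by (force intro!: Min_le image_eqI)
    qed
    show ?thesis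
    proof (rule exI[of _ "c1 - 1"], rule exI[of _ "r1 - 1"], intro conjI allI impI)
      show "restrict_tab M \<tau> (c, r) = Some j \<longleftrightarrow> \<tau> (c + (c1 - 1), r + (r1 - 1)) = Some j \<and> j \<le> M"
        for c r j
        unfolding eq del using pos by simp
      show "\<exists>c' r'. c = c' + (c1 - 1) \<and> r = r' + (r1 - 1)"
        if "\<tau> (c, r) = Some j" "j \<le> M" for c r j
        using ge[OF that] by (intro exI[of _ "c - (c1 - 1)"] exI[of _ "r - (r1 - 1)"]) auto
    qed
  qed
qed

text \<open>The shift d is common to all entries, so it cancels in every content difference and
  hence in every coefficient of the construction.\<close>

lemma (in tableau) CT_restrict_tab:
  assumes "M \<le> n"
  obtains d where "\<And>j. 1 \<le> j \<Longrightarrow> j \<le> M \<Longrightarrow> CT (restrict_tab M \<tau>) j = CT \<tau> j - d"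
proof -
  obtain c0 r0 where tr:
    "\<And>c r j. restrict_tab M \<tau> (c, r) = Some j \<longleftrightarrow> \<tau> (c + c0, r + r0) = Some j \<and> j \<le> M"
    "\<And>c r j. \<tau> (c, r) = Some j \<Longrightarrow> j \<le> M \<Longrightarrow> \<exists>c' r'. c = c' + c0 \<and> r = r' + r0"
    using restrict_tab_translate[OF assms] by blast
  have "CT (restrict_tab M \<tau>) j = CT \<tau> j - (int c0 - int r0)" if j: "1 \<le> j" "j \<le> M" for j
  proof -
    obtain c r where cr: "\<tau> (c, r) = Some j" using box_exists[of j] j assms by auto
    then obtain c' r' where c': "c = c' + c0" "r = r' + r0" using tr(2) j by blast
    have "(THE b. restrict_tab M \<tau> b = Some j) = (c', r')"
    proof (rule the_equality)
      show "restrict_tab M \<tau> (c', r') = Some j" using tr(1) cr c' j by simp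
      show "b = (c', r')" if "restrict_tab M \<tau> b = Some j" for b
        using that tr(1)[of "fst b" "snd b" j] box_unique[OF cr] c' by (cases b) force
    qed
    then show ?thesis using CT_box[OF cr] c' by (simp add: CT_def)
  qed
  then show thesis using that by blast
qed

lemma (in tableau) RST_restrict_tab:
  assumes "M \<le> n" "is_partition \<mu> M" "dom (restrict_tab M \<tau>) = diagram \<mu>"
  shows "RST \<mu> (restrict_tab M \<tau>)"
proof -
  obtain c0 r0 where tr:
    "\<And>c r j. restrict_tab M \<tau> (c, r) = Some j \<longleftrightarrow> \<tau> (c + c0, r + r0) = Some j \<and> j \<le> M"
    "\<And>c r j. \<tau> (c, r) = Some j \<Longrightarrow> j \<le> M \<Longrightarrow> \<exists>c' r'. c = c' + c0 \<and> r = r' + r0"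
    using restrict_tab_translate[OF assms(1)] by blast
  have obt: "\<exists>j. restrict_tab M \<tau> b = Some j" if "b \<in> diagram \<mu>" for b
    using that assms(3) by blast
  have "bij_betw (\<lambda>b. the (restrict_tab M \<tau> b)) (diagram \<mu>) {1..M}"
    unfolding bij_betw_def
  proof
    show "inj_on (\<lambda>b. the (restrict_tab M \<tau> b)) (diagram \<mu>)"
    proof (rule inj_onI)
      fix b b' assume "b \<in> diagram \<mu>" "b' \<in> diagram \<mu>"
        and *: "the (restrict_tab M \<tau> b) = the (restrict_tab M \<tau> b')"
      then obtain j where "restrict_tab M \<tau> b = Some j" "restrict_tab M \<tau> b' = Some j"
        using obt by (metis option.sel)
      then show "b = b'"
        using tr(1)[of "fst b" "snd b" j] tr(1)[of "fst b'" "snd b'" j] box_unique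
        by (cases b; cases b') force
    qed
    show "(\<lambda>b. the (restrict_tab M \<tau> b)) ` diagram \<mu> = {1..M}"
    proof (intro equalityI subsetI)
      fix j assume "j \<in> (\<lambda>b. the (restrict_tab M \<tau> b)) ` diagram \<mu>"
      then obtain b where b: "b \<in> diagram \<mu>" "j = the (restrict_tab M \<tau> b)" by blast
      then have "restrict_tab M \<tau> (fst b, snd b) = Some j" using obt[OF b(1)] by auto
      then have "\<tau> (fst b + c0, snd b + r0) = Some j" "j \<le> M" using tr(1) by blast+
      then show "j \<in> {1..M}" using entry_range by auto
    next
      fix j assume j: "j \<in> {1..M}"
      then obtain c r where cr: "\<tau> (c, r) = Some j" using box_exists[of j] assms(1) by auto
      then obtain c' r' where c': "c = c' + c0" "r = r' + r0" using tr(2)[OF cr] j by auto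
      then have "restrict_tab M \<tau> (c', r') = Some j" using tr(1) cr j by simp
      then show "j \<in> (\<lambda>b. the (restrict_tab M \<tau> b)) ` diagram \<mu>"
        using assms(3) by (intro image_eqI[of _ _ "(c', r')"]) auto
    qed
  qed
  moreover have "sum_list \<mu> = M" using assms(2) by (simp add: is_partition_def)
  moreover have "the (restrict_tab M \<tau> (c', r)) < the (restrict_tab M \<tau> (c, r))"
    if b: "(c, r) \<in> diagram \<mu>" "(c', r) \<in> diagram \<mu>" "c < c'" for c c' r
  proof -
    obtain j j' where j: "restrict_tab M \<tau> (c, r) = Some j" "restrict_tab M \<tau> (c', r) = Some j'"
      using obt b by blast
    then have "j' < j" using tr(1) row_less[of "c + c0" "r + r0" j "c' + c0" j'] b(3) by simp
    then show ?thesis using j by simp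
  qed
  moreover have "the (restrict_tab M \<tau> (c, r')) < the (restrict_tab M \<tau> (c, r))"
    if b: "(c, r) \<in> diagram \<mu>" "(c, r') \<in> diagram \<mu>" "r < r'" for c r r'
  proof -
    obtain j j' where j: "restrict_tab M \<tau> (c, r) = Some j" "restrict_tab M \<tau> (c, r') = Some j'"
      using obt b by blast
    then have "j' < j" using tr(1) col_less[of "c + c0" "r + r0" j "r' + r0" j'] b(3) by simp
    then show ?thesis using j by simp
  qed
  ultimately show ?thesis unfolding RST_def using assms(3) by blast
qed

subsection \<open>Relations between the operators\<close>

text \<open>The action on tableaux has rational coefficients; collecting them inside
  \<open>rat_const\<close> turns operator identities into identities in \<open>rat\<close>.\<close>

definition rat_const :: "rat \<Rightarrow> mpoly" where
  "rat_const q = Const (of_rat q)"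

lemma rat_const_simps:
  "rat_const 0 = 0" "rat_const 1 = 1" "rat_const (a + b) = rat_const a + rat_const b"
  "rat_const (a * b) = rat_const a * rat_const b" "rat_const (- a) = - rat_const a"
  by (simp_all add: rat_const_def of_rat_add of_rat_mult of_rat_minus Const_add Const_mult Const_uminus)

lemma s_op_basis: "s_op i (Poly_Mapping.single \<tau> f) =
    smul (rat_const (axial i \<tau>)) (Poly_Mapping.single \<tau> (s_poly i f)) +
    smul (rat_const (off_coeff (axial i \<tau>))) (Poly_Mapping.single (interchange i \<tau>) (s_poly i f))"
  by (simp add: s_op_single rat_const_def)

lemma s_op_smul_rat [simp]: "s_op i (smul (rat_const c) P) = smul (rat_const c) (s_op i P)"
  by (simp add: rat_const_def)

text \<open>The normalisation is asymmetric, but the operator relations need only this symmetric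
  product. Since d is an integer, b is 1, -1 or of absolute value at most 1/2, so for other b
  exactly one of the two factors is 1.\<close>

lemma off_coeff_mult:
  fixes d :: int
  assumes "d \<noteq> 0" "b = 1 / rat_of_int d"
  shows "off_coeff b * off_coeff (- b) = 1 - b * b"
proof (cases "\<bar>d\<bar> = 1")
  case True
  then have "d = 1 \<or> d = - 1" by auto
  then have "b = 1 \<or> b = - 1" using assms by auto
  then show ?thesis by (auto simp: off_coeff_def)
next
  case False
  then consider "d \<ge> 2" | "d \<le> - 2" using assms by linarith
  then show ?thesis
  proof cases
    case 1
    then have "rat_of_int d \<ge> 2" by linarith
    then have "0 < b" "b \<le> 1 / 2" unfolding assms(2) by (auto simp: field_simps)
    then show ?thesis by (auto simp: off_coeff_def power2_eq_square)
  next
    case 2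
    then have "rat_of_int d \<le> - 2" by linarith
    then have "b < 0" "- (1 / 2) \<le> b" unfolding assms(2) by (auto simp: field_simps)
    then show ?thesis by (auto simp: off_coeff_def power2_eq_square)
  qed
qed

lemma off_coeff_eq_0:
  assumes "\<bar>CT \<tau> i - CT \<tau> (i + 1)\<bar> = 1"
  shows "off_coeff (axial i \<tau>) = 0"
proof -
  have "CT \<tau> i - CT \<tau> (i + 1) = 1 \<or> CT \<tau> i - CT \<tau> (i + 1) = - 1" using assms by auto
  then have "axial i \<tau> = 1 \<or> axial i \<tau> = - 1"
    unfolding axial_def by (auto simp del: of_int_diff)
  then show ?thesis by (auto simp: off_coeff_def)
qed

lemma inverse_int_diff_neg: "1 / rat_of_int (a - b) = - (1 / rat_of_int (b - a))"
  by (metis minus_diff_eq minus_divide_right of_int_minus)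

definition rst_module :: "nat list \<Rightarrow> pmodule set" where
  "rst_module \<nu> = {P. \<forall>\<tau>\<in>Poly_Mapping.keys P. RST \<nu> \<tau>}"

lemma rst_module_0 [simp]: "0 \<in> rst_module \<nu>"
  and rst_module_single: "RST \<nu> \<tau> \<Longrightarrow> Poly_Mapping.single \<tau> f \<in> rst_module \<nu>"
  by (simp_all add: rst_module_def)

lemma rst_module_add: "P \<in> rst_module \<nu> \<Longrightarrow> Q \<in> rst_module \<nu> \<Longrightarrow> P + Q \<in> rst_module \<nu>"
  using keys_add[of P Q] by (auto simp: rst_module_def)

lemma rst_module_smul: "P \<in> rst_module \<nu> \<Longrightarrow> smul f P \<in> rst_module \<nu>"
  by (auto simp: rst_module_def in_keys_iff)

lemma rst_module_induct [consumes 1, case_names zero single add]: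
  assumes "P \<in> rst_module \<nu>" "R 0" "\<And>\<tau> f. RST \<nu> \<tau> \<Longrightarrow> R (Poly_Mapping.single \<tau> f)"
    "\<And>P Q. R P \<Longrightarrow> R Q \<Longrightarrow> R (P + Q)"
  shows "R P"
  using assms(1) unfolding rst_module_def
  by (intro span_induct[of P "RST \<nu>" R]) (use assms in auto)

definition theta :: "nat \<Rightarrow> pmodule \<Rightarrow> pmodule" where
  "theta n = fold s_op [1..<n]"

definition step_op :: "nat \<Rightarrow> ratfun \<Rightarrow> pmodule \<Rightarrow> pmodule" where
  "step_op i c P = s_op i P + smul (Const c) P"

lemma s_op_far_commute:
  assumes "i + 2 \<le> j \<or> j + 2 \<le> i"
  shows "s_op i (s_op j P) = s_op j (s_op i P)"
proof (induction P rule: poly_mapping_add_induct)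
  case (single \<tau> f)
  have "axial i (interchange j \<tau>) = axial i \<tau>" "axial j (interchange i \<tau>) = axial j \<tau>"
    using assms unfolding axial_def by auto
  then show ?case
    by (simp add: s_op_basis s_op_add pmod.scale_right_distrib s_poly_commute[OF assms]
        interchange_commute[OF assms] ac_simps del: smul_single)
qed (simp add: s_op_add)

lemma step_op_far_commute:
  assumes "i + 2 \<le> j \<or> j + 2 \<le> i"
  shows "step_op i c (step_op j d P) = step_op j d (step_op i c P)"
  using s_op_far_commute[OF assms]
  by (simp add: step_op_def s_op_add pmod.scale_right_distrib ac_simps)

lemma fold_s_op_far_commute:
  assumes "\<And>k. k \<in> set ks \<Longrightarrow> k + 2 \<le> j \<or> j + 2 \<le> k"
  shows "fold s_op ks (s_op j P) = s_op j (fold s_op ks P)"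
  using assms
proof (induction ks arbitrary: P)
  case (Cons k ks)
  have "s_op k (s_op j P) = s_op j (s_op k P)"
    using Cons.prems[of k] by (intro s_op_far_commute) auto
  then show ?case using Cons by simp
qed simp

lemma fold_s_op_add: "fold s_op ks (P + Q) = fold s_op ks P + fold s_op ks Q"
  by (induction ks arbitrary: P Q) (auto simp: s_op_add)

lemma fold_s_op_smul_Const: "fold s_op ks (smul (Const c) P) = smul (Const c) (fold s_op ks P)"
  by (induction ks arbitrary: P) auto

lemma theta_add: "theta n (P + Q) = theta n P + theta n Q"
  unfolding theta_def by (rule fold_s_op_add)

context
  fixes \<nu> :: "nat list" and n :: nat
  assumes part: "is_partition \<nu> n"
begin

text \<open>The interchange may leave the RSTs only when the contents differ by 1, and there its
  coefficient vanishes.\<close>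

lemma rst_module_s_op:
  assumes "P \<in> rst_module \<nu>" "1 \<le> i" "i < n"
  shows "s_op i P \<in> rst_module \<nu>"
  using assms(1)
proof (induction P rule: rst_module_induct)
  case (single \<tau> f)
  interpret tableau \<nu> n \<tau> using part single by unfold_locales
  show ?case
  proof (cases "2 \<le> \<bar>CT \<tau> i - CT \<tau> (i + 1)\<bar>")
    case True
    then show ?thesis unfolding s_op_single using single interchange_RST assms
      by (intro rst_module_add rst_module_single) auto
  next
    case False
    moreover have "CT \<tau> i \<noteq> CT \<tau> (i + 1)" using assms by (intro CT_neq_near) auto
    ultimately have "off_coeff (axial i \<tau>) = 0" by (intro off_coeff_eq_0) linarith
    then show ?thesis unfolding s_op_single using single by (auto intro!: rst_module_single)
  qed
qed (simp_all add: s_op_add rst_module_add)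

lemma rst_module_fold:
  assumes "P \<in> rst_module \<nu>" "\<And>k. k \<in> set ks \<Longrightarrow> 1 \<le> k \<and> k < n"
  shows "fold s_op ks P \<in> rst_module \<nu>"
  using assms by (induction ks arbitrary: P) (auto simp: rst_module_s_op)

lemma rst_module_theta: "P \<in> rst_module \<nu> \<Longrightarrow> theta n P \<in> rst_module \<nu>"
  unfolding theta_def by (intro rst_module_fold) auto

lemma rst_module_psi_op: "P \<in> rst_module \<nu> \<Longrightarrow> psi_op n P \<in> rst_module \<nu>"
  unfolding psi_op_def theta_def[symmetric] by (intro rst_module_smul rst_module_theta)

lemma rst_module_step_op:
  "P \<in> rst_module \<nu> \<Longrightarrow> 1 \<le> i \<Longrightarrow> i < n \<Longrightarrow> step_op i c P \<in> rst_module \<nu>"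
  unfolding step_op_def by (intro rst_module_add rst_module_s_op rst_module_smul)

text \<open>On \<tau> and its interchange the action is a 2 by 2 matrix with diagonal b, -b and
  off-diagonal k, k'. Its square is the scalar b^2 + k k' = 1.\<close>

lemma s_op_involution:
  assumes "P \<in> rst_module \<nu>" "1 \<le> i" "i < n"
  shows "s_op i (s_op i P) = P"
  using assms(1)
proof (induction P rule: rst_module_induct)
  case (single \<tau> f)
  interpret tableau \<nu> n \<tau> using part single by unfold_locales
  define b where "b = axial i \<tau>"
  define k k' where "k = off_coeff b" and "k' = off_coeff (- b)"
  have "CT \<tau> i \<noteq> CT \<tau> (i + 1)" using assms by (intro CT_neq_near) auto
  then have kk: "b * b + k * k' = 1"
    using off_coeff_mult[of "CT \<tau> i - CT \<tau> (i + 1)" b] by (simp add: b_def k_def k'_def axial_def)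
  have b': "axial i (interchange i \<tau>) = - b"
    unfolding axial_def b_def by (simp del: of_int_diff) (rule inverse_int_diff_neg)
  let ?e = "Poly_Mapping.single \<tau> f" and ?e' = "Poly_Mapping.single (interchange i \<tau>) f"
  have "s_op i (s_op i ?e) = smul (rat_const (b * b + k * k')) ?e + smul (rat_const (k * b + k * (- b))) ?e'"
    unfolding s_op_basis s_op_add s_op_smul_rat b' s_poly_involution interchange_involution
      b_def[symmetric] k_def[symmetric] k'_def[symmetric]
    unfolding rat_const_simps pmod.scale_left_distrib pmod.scale_right_distrib pmod.scale_scale
    by (simp only: ac_simps)
  then show ?case by (simp add: kk rat_const_simps del: smul_single)
qed (simp_all add: s_op_add)

text \<open>Both sides are expanded over the six fillings obtained by permuting i, i + 1, i + 2. The
  axial distances add up, 1/z = 1/x + 1/y, and this relation \<open>zxy\<close> together with the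
  products \<open>kk\<close> makes the coefficients agree.\<close>

lemma s_op_braid:
  assumes "P \<in> rst_module \<nu>" "1 \<le> i" "Suc i < n"
  shows "s_op i (s_op (Suc i) (s_op i P)) = s_op (Suc i) (s_op i (s_op (Suc i) P))"
  using assms(1)
proof (induction P rule: rst_module_induct)
  case (single \<tau> f)
  interpret tableau \<nu> n \<tau> using part single by unfold_locales
  let ?j = "Suc i"
  define x y z where "x = 1 / rat_of_int (CT \<tau> i - CT \<tau> (i + 1))"
    and "y = 1 / rat_of_int (CT \<tau> (i + 1) - CT \<tau> (i + 2))"
    and "z = 1 / rat_of_int (CT \<tau> i - CT \<tau> (i + 2))"
  have ne: "CT \<tau> i \<noteq> CT \<tau> (i + 1)" "CT \<tau> (i + 1) \<noteq> CT \<tau> (i + 2)" "CT \<tau> i \<noteq> CT \<tau> (i + 2)"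
    using assms by (intro CT_neq_near; simp)+
  have zxy: "z * (x + y) = x * y"
    unfolding x_def y_def z_def using ne by (simp add: divide_simps)
  define kx kx' ky ky' kz where "kx = off_coeff x" and "kx' = off_coeff (- x)"
    and "ky = off_coeff y" and "ky' = off_coeff (- y)" and "kz = off_coeff z"
  have kk: "kx * kx' = 1 - x * x" "ky * ky' = 1 - y * y"
    unfolding kx_def kx'_def ky_def ky'_def using ne
    by (intro off_coeff_mult[of "CT \<tau> i - CT \<tau> (i + 1)"] off_coeff_mult[of "CT \<tau> (i + 1) - CT \<tau> (i + 2)"];
        simp add: x_def y_def)+
  define t1 t2 t12 t21 t3 where "t1 = interchange i \<tau>" and "t2 = interchange ?j \<tau>"
    and "t12 = interchange ?j t1" and "t21 = interchange i t2" and "t3 = interchange i t12"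
  have int: "interchange i \<tau> = t1" "interchange ?j \<tau> = t2" "interchange ?j t1 = t12"
    "interchange i t2 = t21" "interchange i t12 = t3" "interchange ?j t21 = t3"
    "interchange i t1 = \<tau>" "interchange ?j t2 = \<tau>"
    by (simp_all add: t1_def t2_def t12_def t21_def t3_def interchange_braid)
  have ax: "axial i \<tau> = x" "axial ?j \<tau> = y" "axial ?j t1 = z" "axial i t2 = z"
    "axial i t12 = y" "axial ?j t21 = x" "axial i t1 = - x" "axial ?j t2 = - y"
    unfolding axial_def x_def y_def z_def t1_def t2_def t12_def t21_def inverse_int_diff_neg[symmetric]
    by simp_all
  define g where "g = s_poly i (s_poly ?j (s_poly i f))"
  have g': "s_poly ?j (s_poly i (s_poly ?j f)) = g" by (simp add: g_def s_poly_braid)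
  let ?s = "\<lambda>t. Poly_Mapping.single t g"
  have L: "s_op i (s_op ?j (s_op i (Poly_Mapping.single \<tau> f))) =
      smul (rat_const (x * y * x + kx * z * kx')) (?s \<tau>) + smul (rat_const (x * y * kx + kx * z * (- x))) (?s t1) +
      smul (rat_const (x * ky * z)) (?s t2) + smul (rat_const (kx * kz * y)) (?s t12) +
      smul (rat_const (x * ky * kz)) (?s t21) + smul (rat_const (kx * kz * ky)) (?s t3)"
    unfolding s_op_basis s_op_add s_op_smul_rat int ax g_def[symmetric]
      kx_def[symmetric] kx'_def[symmetric] ky_def[symmetric] ky'_def[symmetric] kz_def[symmetric]
    unfolding rat_const_simps pmod.scale_left_distrib pmod.scale_right_distrib pmod.scale_scale
    by (simp only: ac_simps)
  have R: "s_op ?j (s_op i (s_op ?j (Poly_Mapping.single \<tau> f))) =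
      smul (rat_const (y * x * y + ky * z * ky')) (?s \<tau>) + smul (rat_const (y * kx * z)) (?s t1) +
      smul (rat_const (y * x * ky + ky * z * (- y))) (?s t2) + smul (rat_const (y * kx * kz)) (?s t12) +
      smul (rat_const (ky * kz * x)) (?s t21) + smul (rat_const (ky * kz * kx)) (?s t3)"
    unfolding s_op_basis s_op_add s_op_smul_rat int ax g'
      kx_def[symmetric] kx'_def[symmetric] ky_def[symmetric] ky'_def[symmetric] kz_def[symmetric]
    unfolding rat_const_simps pmod.scale_left_distrib pmod.scale_right_distrib pmod.scale_scale
    by (simp only: ac_simps)
  \<comment> \<open>The coefficients of \<tau> itself: their difference factors through x y - z (x +
    y).\<close>
  have "x * y * x + kx * z * kx' = y * x * y + ky * z * ky'"
  proof -
    have "x * y * x + kx * z * kx' - (y * x * y + ky * z * ky') =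
        x * y * (x - y) + z * (kx * kx') - z * (ky * ky')" by (simp add: algebra_simps)
    also have "\<dots> = (x - y) * (x * y - z * (x + y))" unfolding kk by (simp add: algebra_simps)
    finally show ?thesis by (simp add: zxy)
  qed
  moreover have "x * y * kx + kx * z * (- x) = y * kx * z"
    unfolding zxy[symmetric] by (simp add: algebra_simps)
  moreover have "x * ky * z = y * x * ky + ky * z * (- y)"
    unfolding mult.commute[of y x] zxy[symmetric] by (simp add: algebra_simps)
  ultimately show ?case unfolding L R by (simp only: ac_simps)
qed (simp_all add: s_op_add)

text \<open>After s_i^2 = 1 and the braid relation, the two expansions differ only in the terms s_i
  and s_(i+1), whose coefficients p r and q (p + r) are exchanged. For nonzero scalars the condition
  says 1/q = 1/p + 1/r, the additivity of spectral differences.\<close>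

lemma yang_baxter:
  assumes P: "P \<in> rst_module \<nu>" and i: "1 \<le> i" "Suc i < n" and pqr: "p * r = q * (p + r)"
  shows "step_op i r (step_op (Suc i) q (step_op i p P)) =
    step_op (Suc i) p (step_op i q (step_op (Suc i) r P))"
proof -
  let ?A = "s_op i" and ?B = "s_op (Suc i)" and ?c = "\<lambda>c. smul (Const c)"
  have inv: "?A (?A P) = P" "?B (?B P) = P" using s_op_involution[OF P] i by auto
  have br: "?A (?B (?A P)) = ?B (?A (?B P))" using s_op_braid[OF P i] .
  have L: "step_op i r (step_op (Suc i) q (step_op i p P)) =
      ?B (?A (?B P)) + ?c q P + ?c p (?A (?B P)) + ?c r (?B (?A P)) +
      ?c (q * (p + r)) (?A P) + ?c (p * r) (?B P) + ?c (p * q * r) P"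
    unfolding step_op_def s_op_add s_op_smul_Const inv br
    unfolding Const_mult Const_add distrib_left
      pmod.scale_left_distrib pmod.scale_right_distrib pmod.scale_scale
    by (simp only: ac_simps)
  have R: "step_op (Suc i) p (step_op i q (step_op (Suc i) r P)) =
      ?B (?A (?B P)) + ?c q P + ?c p (?A (?B P)) + ?c r (?B (?A P)) +
      ?c (p * r) (?A P) + ?c (q * (p + r)) (?B P) + ?c (p * q * r) P"
    unfolding step_op_def s_op_add s_op_smul_Const inv
    unfolding Const_mult Const_add distrib_left
      pmod.scale_left_distrib pmod.scale_right_distrib pmod.scale_scale
    by (simp only: ac_simps)
  show ?thesis unfolding L R pqr ..
qed

section \<open>Commutation of the s_i with \<theta> and \<Psi>\<close>

lemma theta_s_op:
  assumes P: "P \<in> rst_module \<nu>" and i: "1 \<le> i" "Suc i < n"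
  shows "theta n (s_op (Suc i) P) = s_op i (theta n P)"
proof -
  have "[1..<n] = [1..<i] @ [i..<n]" using i upt_add_eq_append[of 1 i "n - i"] by simp
  then have split: "[1..<n] = [1..<i] @ [i, Suc i] @ [Suc (Suc i)..<n]"
    using i by (simp add: upt_conv_Cons)
  define Q where "Q = fold s_op [1..<i] P"
  have Q: "Q \<in> rst_module \<nu>" unfolding Q_def using P i by (intro rst_module_fold) auto
  have 1: "fold s_op [1..<i] (s_op (Suc i) P) = s_op (Suc i) Q"
    unfolding Q_def by (intro fold_s_op_far_commute) auto
  \<comment> \<open>The factor s_(i+1) passes s_1, ..., s_(i-1), is turned into s_i by the braid
    relation, and leaves past s_(i+2), ..., s_(n-1).\<close>
  have "theta n (s_op (Suc i) P) = fold s_op [Suc (Suc i)..<n] (s_op (Suc i) (s_op i (s_op (Suc i) Q)))"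
    unfolding theta_def split by (simp add: 1[unfolded One_nat_def])
  also have "\<dots> = fold s_op [Suc (Suc i)..<n] (s_op i (s_op (Suc i) (s_op i Q)))"
    using s_op_braid[OF Q i] by simp
  also have "\<dots> = s_op i (fold s_op [Suc (Suc i)..<n] (s_op (Suc i) (s_op i Q)))"
    by (intro fold_s_op_far_commute) auto
  also have "\<dots> = s_op i (theta n P)"
    unfolding theta_def split by (simp add: Q_def)
  finally show ?thesis .
qed

lemma theta_fold_s_op:
  assumes "P \<in> rst_module \<nu>" "\<And>k. k \<in> set ks \<Longrightarrow> 1 \<le> k \<and> Suc k < n"
  shows "theta n (fold s_op (map Suc ks) P) = fold s_op ks (theta n P)"
  using assms
proof (induction ks arbitrary: P)
  case (Cons k ks)
  then have "s_op (Suc k) P \<in> rst_module \<nu>" by (intro rst_module_s_op) auto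
  then show ?case using Cons by (simp add: theta_s_op)
qed simp

lemma psi_op_theta: "psi_op n P = smul (Var n) (theta n P)"
  by (simp add: psi_op_def theta_def)

lemma theta_smul_Const: "theta n (smul (Const c) P) = smul (Const c) (theta n P)"
  unfolding theta_def by (rule fold_s_op_smul_Const)

lemma theta_last: "2 \<le> n \<Longrightarrow> theta n P = s_op (n - 1) (fold s_op [1..<n - 1] P)"
  by (cases n) (auto simp: theta_def)

text \<open>Of the factors of \<theta> only the last one, s_(n-1), moves x_n.\<close>

lemma theta_smul_Var:
  assumes "2 \<le> n"
  shows "theta n (smul (Var n) P) = smul (Var (n - 1)) (theta n P)"
proof -
  have *: "fold s_op ks (smul (Var n) P) = smul (Var n) (fold s_op ks P)"
    if "\<And>k. k \<in> set ks \<Longrightarrow> Suc k < n" for ks P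
    using that
  proof (induction ks arbitrary: P)
    case (Cons k ks)
    have "transpose k (Suc k) n = n" using Cons.prems[of k] by simp
    then show ?case using Cons by (simp add: s_op_smul)
  qed simp
  have "fold s_op [1..<n - 1] (smul (Var n) P) = smul (Var n) (fold s_op [1..<n - 1] P)"
    by (rule *) auto
  then show ?thesis using assms by (simp add: theta_last s_op_smul)
qed

lemma psi_op_step_op:
  assumes "P \<in> rst_module \<nu>" "1 \<le> i" "Suc i < n"
  shows "psi_op n (step_op (Suc i) c P) = step_op i c (psi_op n P)"
  using assms
  by (simp add: psi_op_theta step_op_def theta_add theta_s_op theta_smul_Const
      pmod.scale_right_distrib s_op_smul mult.commute)

text \<open>The initial s_1 cancels the first factor of the first \<theta>. The remaining s_2, ...,
  s_(n-1) come out of the second \<theta> as s_1, ..., s_(n-2), which is \<theta> up to its last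
  factor s_(n-1). The variables contribute x_n x_(n-1), which s_(n-1) fixes.\<close>

lemma psi_op_psi_op_step_op:
  assumes P: "P \<in> rst_module \<nu>" and n: "2 \<le> n"
  shows "psi_op n (psi_op n (step_op 1 c P)) = step_op (n - 1) c (psi_op n (psi_op n P))"
proof -
  have psi2: "psi_op n (psi_op n Q) = smul (Var n * Var (n - 1)) (theta n (theta n Q))" for Q
    using n by (simp add: psi_op_theta theta_smul_Var)
  have 1: "theta n (s_op 1 P) = fold s_op (map Suc [1..<n - 1]) P"
  proof -
    have "[1..<n] = 1 # map Suc [1..<n - 1]"
      using n by (cases n) (auto simp: upt_conv_Cons map_Suc_upt simp del: upt_Suc)
    then show ?thesis using s_op_involution[OF P] n by (simp add: theta_def)
  qed
  have "theta n (theta n (s_op 1 P)) = fold s_op [1..<n - 1] (theta n P)"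
    unfolding 1 using P by (intro theta_fold_s_op) auto
  also have "\<dots> = s_op (n - 1) (theta n (theta n P))"
  proof -
    have "fold s_op [1..<n - 1] (theta n P) \<in> rst_module \<nu>"
      by (intro rst_module_fold rst_module_theta P) auto
    then show ?thesis
      using s_op_involution n by (simp add: theta_last[of "theta n P"])
  qed
  finally have 2: "theta n (theta n (s_op 1 P)) = s_op (n - 1) (theta n (theta n P))" .
  have 3: "s_poly (n - 1) (Var n * Var (n - 1)) = Var n * Var (n - 1)"
    using n by (simp add: s_poly_mult mult.commute)
  show ?thesis
    unfolding psi2 step_op_def theta_add theta_smul_Const 2 s_op_smul 3
    by (simp add: pmod.scale_right_distrib mult.commute)
qed

end

subsection \<open>Vertices and their spectral vectors\<close>

lemma entry_swap_vec:
  assumes "1 \<le> i" "i < length v" "1 \<le> j" "j \<le> length v"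
  shows "entry (swap_vec i v) j = entry v (transpose i (i + 1) j)"
  using assms by (auto simp: entry_def swap_vec_def nth_list_update transpose_def)

lemma length_swap_vec [simp]: "length (swap_vec i v) = length v"
  by (simp add: swap_vec_def)

lemma entry_psi_vec:
  assumes "1 \<le> j" "j \<le> length v"
  shows "entry (psi_vec v) j = (if j = length v then entry v 1 + 1 else entry v (j + 1))"
  using assms by (cases v) (auto simp: entry_def psi_vec_def nth_append nth_tl)

lemma length_psi_vec [simp]: "v \<noteq> [] \<Longrightarrow> length (psi_vec v) = length v"
  by (simp add: psi_vec_def)

lemma sigma_less:
  assumes "i \<in> {1..length v}" "j \<in> {1..length v}"
    and "entry v i > entry v j \<or> entry v i = entry v j \<and> i < j"
  shows "sigma v i < sigma v j"
  unfolding sigma_def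
proof (rule psubset_card_mono)
  show "finite {k \<in> {1..length v}. entry v j < entry v k \<or> entry v k = entry v j \<and> k \<le> j}"
    by simp
  have "j \<in> {k \<in> {1..length v}. entry v j < entry v k \<or> entry v k = entry v j \<and> k \<le> j}"
    "j \<notin> {k \<in> {1..length v}. entry v i < entry v k \<or> entry v k = entry v i \<and> k \<le> i}"
    using assms by auto
  moreover have "{k \<in> {1..length v}. entry v i < entry v k \<or> entry v k = entry v i \<and> k \<le> i}
    \<subseteq> {k \<in> {1..length v}. entry v j < entry v k \<or> entry v k = entry v j \<and> k \<le> j}"
    using assms by auto
  ultimately show "{k \<in> {1..length v}. entry v i < entry v k \<or> entry v k = entry v i \<and> k \<le> i}
    \<subset> {k \<in> {1..length v}. entry v j < entry v k \<or> entry v k = entry v j \<and> k \<le> j}"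
    by blast
qed

lemma sigma_inj_on: "inj_on (sigma v) {1..length v}"
proof (rule inj_onI)
  fix i j assume ij: "i \<in> {1..length v}" "j \<in> {1..length v}" "sigma v i = sigma v j"
  show "i = j"
    using sigma_less[OF ij(1,2)] sigma_less[OF ij(2,1)] ij(3)
    by (metis less_irrefl linorder_cases)
qed

lemma sigma_range: "i \<in> {1..length v} \<Longrightarrow> sigma v i \<in> {1..length v}"
proof -
  assume i: "i \<in> {1..length v}"
  let ?S = "{j \<in> {1..length v}. entry v j > entry v i \<or> entry v j = entry v i \<and> j \<le> i}"
  have "card ?S \<le> card {1..length v}" by (intro card_mono) auto
  moreover have "i \<in> ?S" "finite ?S" using i by simp_all
  then have "card ?S > 0" using card_gt_0_iff by blast
  ultimately show ?thesis unfolding sigma_def by simp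
qed

lemma sigma_image: "sigma v ` {1..length v} = {1..length v}"
  by (rule endo_inj_surj[OF _ _ sigma_inj_on]) (use sigma_range in auto)

lemma sigma_Suc:
  assumes "1 \<le> i" "i < length v" "entry v i = entry v (i + 1)"
  shows "sigma v (i + 1) = sigma v i + 1"
proof -
  let ?S = "{j \<in> {1..length v}. entry v j > entry v i \<or> entry v j = entry v i \<and> j \<le> i}"
  have "{j \<in> {1..length v}. entry v j > entry v (i + 1) \<or> entry v j = entry v (i + 1) \<and> j \<le> i + 1}
      = insert (i + 1) ?S"
    using assms by auto
  moreover have "finite ?S" "i + 1 \<notin> ?S" using assms by auto
  ultimately show ?thesis unfolding sigma_def by simp
qed

text \<open>The swap alters the left-to-right order of positions i and i + 1 only, and as their
  entries differ no tie is decided between them.\<close>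

lemma sigma_swap_vec:
  assumes i: "1 \<le> i" "i < length v" and j: "1 \<le> j" "j \<le> length v"
    and ne: "entry v i \<noteq> entry v (i + 1)"
  shows "sigma (swap_vec i v) j = sigma v (transpose i (i + 1) j)"
proof -
  let ?t = "transpose i (i + 1)"
  let ?n = "length v"
  have t: "?t k \<in> {1..?n} \<longleftrightarrow> k \<in> {1..?n}" for k using i by (auto simp: transpose_def)
  have ord: "k \<le> j \<longleftrightarrow> ?t k \<le> ?t j" if "entry v (?t k) = entry v (?t j)" for k
    using ne that by (auto simp: transpose_def split: if_splits)
  have "bij_betw ?t {k \<in> {1..?n}. entry v (?t k) > entry v (?t j) \<or> entry v (?t k) = entry v (?t j) \<and> k \<le> j}
     {k \<in> {1..?n}. entry v k > entry v (?t j) \<or> entry v k = entry v (?t j) \<and> k \<le> ?t j}"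
    by (rule bij_betw_byWitness[where f' = ?t]) (use t ord in auto)
  moreover have "{k \<in> {1..?n}. entry (swap_vec i v) k > entry (swap_vec i v) j \<or>
      entry (swap_vec i v) k = entry (swap_vec i v) j \<and> k \<le> j} =
    {k \<in> {1..?n}. entry v (?t k) > entry v (?t j) \<or> entry v (?t k) = entry v (?t j) \<and> k \<le> j}"
    using entry_swap_vec[OF i] j by auto
  ultimately show ?thesis unfolding sigma_def length_swap_vec by (simp add: bij_betw_same_card)
qed

text \<open>The moved entry used to win ties by standing first; now it wins them by being larger by
  one. Entries that exceeded it by one now tie with it and still come first, because it stands last.
  So no rank changes.\<close>

lemma sigma_psi_vec:
  assumes j: "1 \<le> j" "j \<le> length v"
  shows "sigma (psi_vec v) j = sigma v (if j = length v then 1 else j + 1)"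
proof -
  let ?n = "length v"
  define r where "r k = (if k = ?n then 1 else k + 1)" for k
  define r' where "r' k = (if k = 1 then ?n else k - 1)" for k
  have "v \<noteq> []" using j by auto
  have "bij_betw r {k \<in> {1..?n}. entry (psi_vec v) k > entry (psi_vec v) j \<or>
      entry (psi_vec v) k = entry (psi_vec v) j \<and> k \<le> j}
     {k \<in> {1..?n}. entry v k > entry v (r j) \<or> entry v k = entry v (r j) \<and> k \<le> r j}"
    by (rule bij_betw_byWitness[where f' = r']) (use j in \<open>auto simp: r_def r'_def entry_psi_vec split: if_splits\<close>)
  then show ?thesis
    unfolding sigma_def r_def using \<open>v \<noteq> []\<close> by (simp add: bij_betw_same_card)
qed

section \<open>Spectral vectors as coordinates for the vertices\<close>

type_synonym node = "filling \<times> nat list"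

text \<open>The two coefficients of \<zeta> as a polynomial in \<alpha>. As a pair they can be
  compared, which decides the direction of edges.\<close>

definition spec :: "node \<Rightarrow> nat \<Rightarrow> nat \<times> int" where
  "spec w i = (entry (snd w) i, CT (fst w) (sigma (snd w) i))"

definition spec_val :: "nat \<times> int \<Rightarrow> ratfun" where
  "spec_val a = alpha * of_nat (fst a) + of_int (snd a)"

text \<open>Comparing the spectral values at \<open>i\<close> and \<open>i + 1\<close> decides whether the \<open>s\<^sub>i\<close>-edge leads
  upwards, whichever of the two kinds it is.\<close>

definition spec_less :: "nat \<times> int \<Rightarrow> nat \<times> int \<Rightarrow> bool" where
  "spec_less a b \<longleftrightarrow> fst a < fst b \<or> fst a = fst b \<and> snd a - snd b \<ge> 2"

text \<open>One function for both kinds of s_i-edges. It ignores their direction, so it also walks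
  them backwards; as it is total, its result may fail to be a vertex.\<close>

definition s_node :: "nat \<Rightarrow> node \<Rightarrow> node" where
  "s_node i w = (if entry (snd w) i = entry (snd w) (i + 1)
     then (interchange (sigma (snd w) i) (fst w), snd w) else (fst w, swap_vec i (snd w)))"

definition psi_node :: "node \<Rightarrow> node" where
  "psi_node w = (fst w, psi_vec (snd w))"

definition raise :: "nat \<times> int \<Rightarrow> nat \<times> int" where
  "raise a = (fst a + 1, snd a)"

lemma zeta_spec: "zeta v \<tau> i = spec_val (spec (\<tau>, v) i)"
  by (simp add: zeta_def spec_val_def spec_def)

lemma spec_less_trans: "spec_less a b \<Longrightarrow> spec_less b c \<Longrightarrow> spec_less a c"
  by (auto simp: spec_less_def)

lemma spec_less_raise [simp]: "spec_less (raise a) (raise b) \<longleftrightarrow> spec_less a b"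
  by (auto simp: spec_less_def raise_def)

lemma spec_val_raise_diff [simp]: "spec_val (raise a) - spec_val (raise b) = spec_val a - spec_val b"
  by (simp add: spec_val_def raise_def algebra_simps)

lemma of_nat_fract: "(of_nat k :: ratfun) = Fract (of_nat k) 1"
  by (rule Fract_of_nat_eq[symmetric])

lemma of_int_fract: "(of_int k :: ratfun) = Fract (of_int k) 1"
  by (cases k rule: int_diff_cases) (simp add: of_nat_fract)

text \<open>Both values are linear polynomials in the indeterminate \<alpha>, so their coefficients
  can be compared. Hence the denominators occurring along edges do not vanish.\<close>

lemma spec_val_inj: "spec_val a = spec_val b \<Longrightarrow> a = b"
proof -
  have *: "spec_val a = Fract [: of_int (snd a), of_nat (fst a) :] 1" for a
    by (simp add: spec_val_def alpha_def of_nat_fract of_int_fract of_nat_poly of_int_poly)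
  assume "spec_val a = spec_val b"
  then show "a = b" by (simp add: * eq_fract prod_eq_iff)
qed

lemma spec_less_val: "spec_less a b \<Longrightarrow> spec_val a \<noteq> spec_val b"
  using spec_val_inj[of a b] by (auto simp: spec_less_def)

locale jack_graph =
  fixes \<nu> :: "nat list" and n :: nat
  assumes part: "is_partition \<nu> n" and RST_exists: "\<exists>\<tau>. RST \<nu> \<tau>"
begin

lemma sum_shape: "sum_list \<nu> = n"
  using part by (simp add: is_partition_def)

definition valid :: "node \<Rightarrow> bool" where
  "valid w \<longleftrightarrow> RST \<nu> (fst w) \<and> length (snd w) = n"

text \<open>The first components give the vector. As \<sigma> is a permutation of the positions, the
  second components then give all contents, and these determine the tableau.\<close>

lemma node_eqI:
  assumes w: "valid w" "valid w'" and eq: "\<And>i. 1 \<le> i \<Longrightarrow> i \<le> n \<Longrightarrow> spec w i = spec w' i"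
  shows "w = w'"
proof -
  obtain \<tau> v where wd: "w = (\<tau>, v)" by (cases w)
  obtain \<tau>' v' where wd': "w' = (\<tau>', v')" by (cases w')
  have len: "length v = n" "length v' = n" using w by (auto simp: valid_def wd wd')
  have v: "v = v'"
  proof (rule nth_equalityI)
    fix i assume "i < length v"
    then show "v ! i = v' ! i" using eq[of "Suc i"] len by (simp add: spec_def entry_def wd wd')
  qed (simp add: len)
  have "\<tau> = \<tau>'"
  proof (rule RST_eq_if_CT_eq[OF part])
    fix k assume "k \<in> {1..n}"
    then have "k \<in> sigma v ` {1..n}" using sigma_image[of v] len by simp
    then obtain i where "i \<in> {1..n}" "k = sigma v i" by blast
    then show "CT \<tau> k = CT \<tau>' k" using eq[of i] v by (simp add: spec_def wd wd')
  qed (use w in \<open>auto simp: valid_def wd wd'\<close>)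
  then show ?thesis using v wd wd' by simp
qed

text \<open>For equal entries the ranks of i and i + 1 are consecutive, so interchanging these two
  numbers in the tableau swaps the contents; for different entries the swap of the vector carries
  the ranks along.\<close>

lemma spec_s_node:
  assumes w: "valid w" and i: "1 \<le> i" "i < n" and j: "1 \<le> j" "j \<le> n"
  shows "spec (s_node i w) j = spec w (transpose i (i + 1) j)"
proof -
  obtain \<tau> v where wd: "w = (\<tau>, v)" by (cases w)
  have len: "length v = n" using w by (simp add: valid_def wd)
  show ?thesis
  proof (cases "entry v i = entry v (i + 1)")
    case True
    have "sigma v (i + 1) = sigma v i + 1" using True i len by (intro sigma_Suc) auto
    moreover have "sigma v j \<noteq> sigma v i" if "j \<noteq> i"
      using that inj_onD[OF sigma_inj_on[of v], of j i] i j len by auto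
    moreover have "sigma v j \<noteq> sigma v (i + 1)" if "j \<noteq> i + 1"
      using that inj_onD[OF sigma_inj_on[of v], of j "i + 1"] i j len by auto
    ultimately show ?thesis
      using True by (auto simp: s_node_def spec_def wd transpose_def)
  next
    case False
    then show ?thesis
      using i j len by (simp add: s_node_def spec_def wd entry_swap_vec sigma_swap_vec)
  qed
qed

lemma spec_psi_node:
  assumes w: "valid w" and j: "1 \<le> j" "j \<le> n"
  shows "spec (psi_node w) j = (if j = n then raise (spec w 1) else spec w (j + 1))"
  using assms by (auto simp: valid_def psi_node_def spec_def raise_def entry_psi_vec sigma_psi_vec)

lemma valid_psi_node: "valid w \<Longrightarrow> 1 \<le> n \<Longrightarrow> valid (psi_node w)"
  by (cases "snd w") (auto simp: valid_def psi_node_def)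

lemma valid_s_node:
  assumes w: "valid w" and i: "1 \<le> i" "i < n"
    and less: "spec_less (spec w i) (spec w (i + 1)) \<or> spec_less (spec w (i + 1)) (spec w i)"
  shows "valid (s_node i w)"
proof -
  obtain \<tau> v where wd: "w = (\<tau>, v)" by (cases w)
  have len: "length v = n" and R: "RST \<nu> \<tau>" using w by (auto simp: valid_def wd)
  interpret tableau \<nu> n \<tau> using part R by unfold_locales
  show ?thesis
  proof (cases "entry v i = entry v (i + 1)")
    case True
    have s: "sigma v (i + 1) = sigma v i + 1" using True i len by (intro sigma_Suc) auto
    have "RST \<nu> (interchange (sigma v i) \<tau>)"
    proof (rule interchange_RST)
      show "1 \<le> sigma v i" "sigma v i < n"
        using sigma_range[of i v] sigma_range[of "i + 1" v] s i len by auto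
      show "2 \<le> \<bar>CT \<tau> (sigma v i) - CT \<tau> (sigma v i + 1)\<bar>"
        using less s True by (auto simp: spec_less_def spec_def wd)
    qed
    then show ?thesis using True len by (simp add: valid_def s_node_def wd)
  next
    case False
    then show ?thesis using len R by (simp add: valid_def s_node_def wd)
  qed
qed

lemma s_node_involution:
  assumes w: "valid w" and i: "1 \<le> i" "i < n"
    and less: "spec_less (spec w i) (spec w (i + 1)) \<or> spec_less (spec w (i + 1)) (spec w i)"
  shows "s_node i (s_node i w) = w"
proof (rule node_eqI[OF _ w])
  have v: "valid (s_node i w)" by (rule valid_s_node[OF assms])
  show "valid (s_node i (s_node i w))"
    by (rule valid_s_node[OF v i]) (use less i in \<open>auto simp: spec_s_node[OF w i]\<close>)
  fix j assume j: "1 \<le> j" "j \<le> n"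
  then have "1 \<le> transpose i (i + 1) j" "transpose i (i + 1) j \<le> n"
    using i by (auto simp: transpose_def)
  then show "spec (s_node i (s_node i w)) j = spec w j"
    using spec_s_node[OF v i j] spec_s_node[OF w i] by simp
qed

section \<open>A well-founded order in which every edge goes up\<close>

definition pos_weight :: "nat list \<Rightarrow> nat" where
  "pos_weight v = (\<Sum>j\<in>{1..n}. (n - j) * entry v j)"

text \<open>\<Psi> raises the sum of the vector; a swap keeps it and moves a larger entry to the
  left, where \<open>pos_weight\<close> is heavier; a tableau edge keeps the vector and raises
  \<open>tab_measure\<close>.\<close>

definition node_order :: "(node \<times> node) set" where
  "node_order = measures [\<lambda>w. sum_list (snd w), \<lambda>w. pos_weight (snd w), \<lambda>w. tab_measure \<nu> n (fst w)]"

lemma wf_node_order: "wf node_order"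
  by (simp add: node_order_def)

lemma trans_node_order: "(u, v) \<in> node_order \<Longrightarrow> (v, w) \<in> node_order \<Longrightarrow> (u, w) \<in> node_order"
  by (auto simp: node_order_def)

lemma pos_weight_swap_vec:
  assumes i: "1 \<le> i" "i < n" and len: "length v = n" and less: "entry v i < entry v (i + 1)"
  shows "pos_weight v < pos_weight (swap_vec i v)"
proof -
  let ?v' = "swap_vec i v" and ?R = "{1..n} - {i, i + 1}"
  have split: "pos_weight u = (\<Sum>j\<in>?R. (n - j) * entry u j) + ((n - i) * entry u i + (n - (i + 1)) * entry u (i + 1))"
    for u
  proof -
    have "pos_weight u = (\<Sum>j\<in>?R. (n - j) * entry u j) + (\<Sum>j\<in>{i, i + 1}. (n - j) * entry u j)"
      unfolding pos_weight_def using i by (intro sum.subset_diff) auto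
    then show ?thesis by simp
  qed
  have "(\<Sum>j\<in>?R. (n - j) * entry ?v' j) = (\<Sum>j\<in>?R. (n - j) * entry v j)"
    using i len by (intro sum.cong refl) (simp add: entry_swap_vec)
  moreover have "entry ?v' i = entry v (i + 1)" "entry ?v' (i + 1) = entry v i"
    using i len by (auto simp: entry_swap_vec)
  moreover have "(n - i) * entry v i + (n - (i + 1)) * entry v (i + 1) <
      (n - i) * entry v (i + 1) + (n - (i + 1)) * entry v i"
  proof -
    have "n - i = Suc (n - (i + 1))" using i by simp
    then show ?thesis using less by simp
  qed
  ultimately show ?thesis unfolding split[of v] split[of ?v'] by simp
qed

lemma sum_list_swap_vec:
  assumes "1 \<le> i" "i < length v"
  shows "sum_list (swap_vec i v) = sum_list v"
proof -
  have "mset (swap_vec i v) = mset v"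
    using mset_swap[of i v "i - 1"] assms by (simp add: swap_vec_def entry_def)
  then show ?thesis by (metis sum_mset_sum_list)
qed

lemma s_node_increases:
  assumes w: "valid w" and i: "1 \<le> i" "i < n" and less: "spec_less (spec w i) (spec w (i + 1))"
  shows "(w, s_node i w) \<in> node_order"
proof -
  obtain \<tau> v where wd: "w = (\<tau>, v)" by (cases w)
  have len: "length v = n" and R: "RST \<nu> \<tau>" using w by (auto simp: valid_def wd)
  interpret tableau \<nu> n \<tau> using part R by unfold_locales
  show ?thesis
  proof (cases "entry v i = entry v (i + 1)")
    case True
    have s: "sigma v (i + 1) = sigma v i + 1" using True i len by (intro sigma_Suc) auto
    have "tab_measure \<nu> n \<tau> < tab_measure \<nu> n (interchange (sigma v i) \<tau>)"
    proof (rule tab_measure_interchange)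
      show "1 \<le> sigma v i" "sigma v i < n"
        using sigma_range[of i v] sigma_range[of "i + 1" v] s i len by auto
      show "2 \<le> CT \<tau> (sigma v i) - CT \<tau> (sigma v i + 1)"
        using less s True by (auto simp: spec_less_def spec_def wd)
    qed
    then show ?thesis using True by (simp add: node_order_def s_node_def wd)
  next
    case False
    then have "entry v i < entry v (i + 1)" using less by (auto simp: spec_less_def spec_def wd)
    then show ?thesis using False pos_weight_swap_vec sum_list_swap_vec i len
      by (simp add: node_order_def s_node_def wd)
  qed
qed

lemma psi_node_increases: "valid w \<Longrightarrow> 1 \<le> n \<Longrightarrow> (w, psi_node w) \<in> node_order"
  by (cases w; cases "snd w") (auto simp: node_order_def psi_node_def psi_vec_def valid_def)

lemma psi_node_inj:
  assumes "valid u" "valid u'" "psi_node u = psi_node u'" "1 \<le> n"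
  shows "u = u'"
proof -
  have "snd u \<noteq> []" "snd u' \<noteq> []" using assms by (auto simp: valid_def)
  then show ?thesis
    using assms(3) by (cases u; cases u'; cases "snd u"; cases "snd u'") (auto simp: psi_node_def psi_vec_def)
qed

lemma psi_node_surj:
  assumes w: "valid w" and n: "1 \<le> n" and pos: "0 < fst (spec w n)"
  obtains u where "valid u" "psi_node u = w"
proof -
  obtain \<tau> v where wd: "w = (\<tau>, v)" by (cases w)
  have len: "length v = n" using w by (simp add: valid_def wd)
  then obtain xs x where v: "v = xs @ [x]" using n by (cases v rule: rev_cases) auto
  have "x > 0" using pos len n by (auto simp: spec_def entry_def wd v nth_append)
  then have "psi_node (\<tau>, (x - 1) # xs) = w" by (simp add: psi_node_def psi_vec_def wd v)
  moreover have "valid (\<tau>, (x - 1) # xs)" using w by (simp add: valid_def wd v)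
  ultimately show thesis using that by blast
qed

section \<open>Edges seen from their target\<close>

definition step_coeff :: "node \<Rightarrow> nat \<Rightarrow> ratfun" where
  "step_coeff w i = 1 / (spec_val (spec w i) - spec_val (spec w (i + 1)))"

text \<open>An s_i-edge exchanges the spectral values at i and i + 1, so its source and its scalar
  can be read off at the target; the exchange is why \<open>step_coeff\<close> has the opposite
  order of subtraction from the edge rule.\<close>

lemma descend:
  assumes w: "valid w" and i: "1 \<le> i" "i < n" and less: "spec_less (spec w (i + 1)) (spec w i)"
  shows "valid (s_node i w)" "(s_node i w, w) \<in> node_order"
    and "jack_at \<nu> (Some (s_node i w)) P \<Longrightarrow> jack_at \<nu> (Some w) (step_op i (step_coeff w i) P)"
proof -
  let ?u = "s_node i w"
  show u: "valid ?u" by (rule valid_s_node[OF w i]) (use less in blast)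
  have bk: "s_node i ?u = w" by (rule s_node_involution[OF w i]) (use less in blast)
  have spec: "spec ?u i = spec w (i + 1)" "spec ?u (i + 1) = spec w i"
    using spec_s_node[OF w i] i by auto
  have less': "spec_less (spec ?u i) (spec ?u (i + 1))" using less spec by simp
  show "(?u, w) \<in> node_order" using s_node_increases[OF u i less'] bk by simp
  assume P: "jack_at \<nu> (Some ?u) P"
  obtain \<tau> v where ud: "?u = (\<tau>, v)" by (cases ?u)
  have bk': "s_node i (\<tau>, v) = w" using bk ud by simp
  have len: "length v = n" using u by (simp add: valid_def ud)
  have "edge \<nu> (Some (\<tau>, v)) (S i) (Some w)"
  proof (cases "entry v i = entry v (i + 1)")
    case True
    then have "w = (interchange (sigma v i) \<tau>, v)" using bk' by (simp add: s_node_def)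
    moreover have "sigma v (i + 1) = sigma v i + 1" using True i len by (intro sigma_Suc) auto
    then have "CT \<tau> (sigma v i) - CT \<tau> (sigma v i + 1) \<ge> 2"
      using less' True by (simp add: spec_less_def spec_def ud)
    ultimately show ?thesis using True i len by (auto intro: edge.tableau_edge)
  next
    case False
    then have "w = (\<tau>, swap_vec i v)" using bk' by (simp add: s_node_def)
    moreover have "entry v i < entry v (i + 1)"
      using less' False by (auto simp: spec_less_def spec_def ud)
    ultimately show ?thesis using i len by (auto intro: edge.swap_edge)
  qed
  from jack_at.S_step[OF P[unfolded ud] this]
  show "jack_at \<nu> (Some w) (step_op i (step_coeff w i) P)"
    using spec by (simp add: step_op_def step_coeff_def zeta_spec ud)
qed

lemma jack_psi:
  assumes "valid u" "1 \<le> n" "jack_at \<nu> (Some u) P"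
  shows "jack_at \<nu> (Some (psi_node u)) (psi_op n P)"
proof -
  have "edge \<nu> (Some (fst u, snd u)) Psi (Some (psi_node u))"
    unfolding psi_node_def using assms by (intro edge.Psi_edge) (auto simp: valid_def)
  then show ?thesis using jack_at.Psi_step[of \<nu> "fst u" "snd u" P] assms(3) sum_shape by auto
qed

definition root_node :: node where
  "root_node = (root_tableau \<nu>, replicate n 0)"

lemma valid_root: "valid root_node"
  using RST_exists root_tableau_minimal(1)[OF part] by (auto simp: valid_def root_node_def)

lemma root_node_minimal: "valid u \<Longrightarrow> (u, root_node) \<notin> node_order"
proof -
  assume u: "valid u"
  have "pos_weight (replicate n 0) = 0" by (auto simp: pos_weight_def entry_def)
  then show ?thesis using root_tableau_minimal(2)[OF part, of "fst u"] u
    by (simp add: node_order_def root_node_def valid_def sum_list_replicate)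
qed

lemma edge_target:
  assumes "edge \<nu> (Some u) l (Some w)" "valid u"
  shows "l = Psi \<and> 1 \<le> n \<and> w = psi_node u \<or>
    (\<exists>i. l = S i \<and> 1 \<le> i \<and> i < n \<and> spec_less (spec u i) (spec u (i + 1)) \<and> w = s_node i u)"
  using assms(1)
proof cases
  case (Psi_edge v \<tau>)
  then show ?thesis using assms(2) by (cases v) (auto simp: psi_node_def valid_def)
next
  case (swap_edge i v \<tau>)
  then show ?thesis using assms(2) by (auto simp: s_node_def valid_def spec_less_def spec_def)
next
  case (tableau_edge i v \<tau>)
  then have "sigma v (i + 1) = sigma v i + 1" by (intro sigma_Suc) auto
  then show ?thesis using tableau_edge assms(2)
    by (auto simp: s_node_def valid_def spec_less_def spec_def)
qed

lemma edge_fall: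
  assumes "edge \<nu> (Some u) l None" "valid u"
  shows "\<exists>i. l = S i \<and> 1 \<le> i \<and> i < n"
  using assms(1) by cases (use assms(2) in \<open>auto simp: valid_def\<close>)

text \<open>The second part makes the operator relations applicable to every value in the graph. The
  vertex is optional because a step may end in \<open>None\<close>, where a value is still
  produced.\<close>

lemma jack_at_valid:
  assumes "jack_at \<nu> wo P"
  shows "(\<forall>w. wo = Some w \<longrightarrow> valid w) \<and> P \<in> rst_module \<nu>"
  using assms
proof induction
  case root
  then show ?case using valid_root
    by (auto simp: root_node_def valid_def sum_shape intro: rst_module_single)
next
  case (Psi_step \<tau> v P w)
  then have u: "valid (\<tau>, v)" "P \<in> rst_module \<nu>" by auto
  show ?case
  proof (cases w)
    case None
    then show ?thesis using edge_fall[of "(\<tau>, v)" Psi] Psi_step u by auto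
  next
    case (Some w')
    then have "1 \<le> n" "w' = psi_node (\<tau>, v)" using edge_target[of "(\<tau>, v)" Psi w'] Psi_step u by auto
    then show ?thesis
      using Some valid_psi_node[OF u(1)] rst_module_psi_op[OF part u(2)] sum_shape by simp
  qed
next
  case (S_step \<tau> v P i w)
  then have u: "valid (\<tau>, v)" "P \<in> rst_module \<nu>" by auto
  have i: "1 \<le> i" "i < n"
    using edge_fall[of "(\<tau>, v)" "S i"] edge_target[of "(\<tau>, v)" "S i"] S_step(2) u
    by (cases w; auto)+
  have "valid w'" if "w = Some w'" for w'
    using edge_target[of "(\<tau>, v)" "S i" w'] S_step(2) u that valid_s_node[OF u(1) i] by auto
  then show ?case using rst_module_step_op[OF part u(2) i] by (auto simp: step_op_def)
qed

lemma jack_at_cases [consumes 1, case_names root psi s]: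
  assumes "jack_at \<nu> (Some w) P"
  obtains "w = root_node" "P = Poly_Mapping.single (root_tableau \<nu>) 1"
  | u P' where "valid u" "1 \<le> n" "w = psi_node u" "jack_at \<nu> (Some u) P'" "P = psi_op n P'"
  | i P' where "1 \<le> i" "i < n" "spec_less (spec w (i + 1)) (spec w i)"
      "jack_at \<nu> (Some (s_node i w)) P'" "P = step_op i (step_coeff w i) P'"
  using assms
proof cases
  case root
  then show ?thesis using that(1) by (simp add: root_node_def sum_shape)
next
  case (Psi_step \<tau> v P')
  then have u: "valid (\<tau>, v)" using jack_at_valid by blast
  then show ?thesis using edge_target[OF Psi_step(3) u] that(2)[OF u] Psi_step sum_shape by auto
next
  case (S_step \<tau> v P' i)
  then have u: "valid (\<tau>, v)" using jack_at_valid by blast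
  have i: "1 \<le> i" "i < n" and less: "spec_less (spec (\<tau>, v) i) (spec (\<tau>, v) (i + 1))"
    and w: "w = s_node i (\<tau>, v)"
    using edge_target[OF S_step(3) u] by auto
  have spec: "spec w i = spec (\<tau>, v) (i + 1)" "spec w (i + 1) = spec (\<tau>, v) i"
    using spec_s_node[OF u i] i w by auto
  have "s_node i w = (\<tau>, v)" unfolding w using less by (intro s_node_involution[OF u i]) auto
  then show ?thesis
    using that(3)[OF i, of P'] less spec S_step
    by (simp add: step_op_def step_coeff_def zeta_spec)
qed

end

subsection \<open>Path independence\<close>

context jack_graph
begin

text \<open>The pattern of all three diamonds: go further down to a common vertex, take its value R
  from existence below w, and identify P1 and P2 with values computed from R by uniqueness below w.
  An operator relation then compares the two ways up.\<close>

lemma diamond_far: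
  assumes w: "valid w"
    and IH: "\<And>u. valid u \<Longrightarrow> (u, w) \<in> node_order \<Longrightarrow> \<exists>!P. jack_at \<nu> (Some u) P"
    and i: "1 \<le> i" "i < n" and j: "1 \<le> j" "j < n" and far: "i + 2 \<le> j \<or> j + 2 \<le> i"
    and li: "spec_less (spec w (i + 1)) (spec w i)" and lj: "spec_less (spec w (j + 1)) (spec w j)"
    and P1: "jack_at \<nu> (Some (s_node i w)) P1" and P2: "jack_at \<nu> (Some (s_node j w)) P2"
  shows "step_op i (step_coeff w i) P1 = step_op j (step_coeff w j) P2"
proof -
  define u1 u2 where "u1 = s_node i w" and "u2 = s_node j w"
  note u1 = descend(1,2)[OF w i li, folded u1_def] and u2 = descend(1,2)[OF w j lj, folded u2_def]
  have s1: "spec u1 k = spec w (transpose i (i + 1) k)" if "1 \<le> k" "k \<le> n" for k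
    unfolding u1_def using spec_s_node[OF w i that] .
  have s2: "spec u2 k = spec w (transpose j (j + 1) k)" if "1 \<le> k" "k \<le> n" for k
    unfolding u2_def using spec_s_node[OF w j that] .
  have l1: "spec_less (spec u1 (j + 1)) (spec u1 j)" using lj far j by (auto simp: s1)
  have l2: "spec_less (spec u2 (i + 1)) (spec u2 i)" using li far i by (auto simp: s2)
  define x where "x = s_node j u1"
  note x = descend[OF u1(1) j l1, folded x_def] and x2 = descend[OF u2(1) i l2]
  have x_eq: "s_node i u2 = x"
  proof (rule node_eqI[OF x2(1) x(1)])
    fix k assume k: "1 \<le> k" "k \<le> n"
    have "1 \<le> transpose i (i + 1) k" "transpose i (i + 1) k \<le> n"
      "1 \<le> transpose j (j + 1) k" "transpose j (j + 1) k \<le> n"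
      using k i j by (auto simp: transpose_def)
    moreover have "transpose i (i + 1) (transpose j (j + 1) k) = transpose j (j + 1) (transpose i (i + 1) k)"
      using far by (auto simp: transpose_def)
    ultimately show "spec (s_node i u2) k = spec x k"
      unfolding x_def using spec_s_node[OF u2(1) i k] spec_s_node[OF u1(1) j k] by (simp add: s1 s2)
  qed
  obtain R where R: "jack_at \<nu> (Some x) R"
    using IH[OF x(1)] trans_node_order[OF x(2) u1(2)] by blast
  have "P1 = step_op j (step_coeff u1 j) R"
    using IH[OF u1] P1 x(3)[OF R] unfolding u1_def by blast
  moreover have "P2 = step_op i (step_coeff u2 i) R"
    using IH[OF u2] P2 x2(3)[unfolded x_eq, OF R] unfolding u2_def by blast
  moreover have "step_coeff u1 j = step_coeff w j" "step_coeff u2 i = step_coeff w i"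
    using far i j by (auto simp: step_coeff_def s1 s2)
  ultimately show ?thesis using step_op_far_commute[OF far] by simp
qed

lemma diamond_adjacent:
  assumes w: "valid w"
    and IH: "\<And>u. valid u \<Longrightarrow> (u, w) \<in> node_order \<Longrightarrow> \<exists>!P. jack_at \<nu> (Some u) P"
    and i: "1 \<le> i" "Suc i < n"
    and li: "spec_less (spec w (i + 1)) (spec w i)"
    and lj: "spec_less (spec w (Suc i + 1)) (spec w (Suc i))"
    and P1: "jack_at \<nu> (Some (s_node i w)) P1" and P2: "jack_at \<nu> (Some (s_node (Suc i) w)) P2"
  shows "step_op i (step_coeff w i) P1 = step_op (Suc i) (step_coeff w (Suc i)) P2"
proof -
  let ?j = "Suc i"
  have i': "1 \<le> i" "i < n" and j: "1 \<le> ?j" "?j < n" using i by auto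
  define a b c where "a = spec w i" and "b = spec w (i + 1)" and "c = spec w (i + 2)"
  have bc: "spec_less c b" and ab: "spec_less b a" using li lj by (simp_all add: a_def b_def c_def)
  have ac: "spec_less c a" using spec_less_trans[OF bc ab] .
  have tr: "1 \<le> transpose k (k + 1) l" "transpose k (k + 1) l \<le> n"
    if "1 \<le> k" "k < n" "1 \<le> l" "l \<le> n" for k l
    using that by (auto simp: transpose_def)
  define u1 u2 where "u1 = s_node i w" and "u2 = s_node ?j w"
  note u1 = descend(1,2)[OF w i' li, folded u1_def] and u2 = descend(1,2)[OF w j lj, folded u2_def]
  note s1 = spec_s_node[OF w i', folded u1_def] and s2 = spec_s_node[OF w j, folded u2_def]
  have u1s: "spec u1 i = b" "spec u1 (Suc i) = a" "spec u1 (Suc (Suc i)) = c"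
    using i by (simp_all add: s1 a_def b_def c_def)
  have u2s: "spec u2 i = a" "spec u2 (Suc i) = c" "spec u2 (Suc (Suc i)) = b"
    using i by (simp_all add: s2 a_def b_def c_def)
  have l1: "spec_less (spec u1 (?j + 1)) (spec u1 ?j)" using ac u1s by simp
  have l2: "spec_less (spec u2 (i + 1)) (spec u2 i)" using ac u2s by simp
  define x1 x2 where "x1 = s_node ?j u1" and "x2 = s_node i u2"
  note x1 = descend[OF u1(1) j l1, folded x1_def] and x2 = descend[OF u2(1) i' l2, folded x2_def]
  note t1 = spec_s_node[OF u1(1) j, folded x1_def] and t2 = spec_s_node[OF u2(1) i', folded x2_def]
  have x1s: "spec x1 i = b" "spec x1 (Suc i) = c" "spec x1 (Suc (Suc i)) = a"
    using i u1s by (simp_all add: t1)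
  have x2s: "spec x2 i = c" "spec x2 (Suc i) = a" "spec x2 (Suc (Suc i)) = b"
    using i u2s by (simp_all add: t2)
  have m1: "spec_less (spec x1 (i + 1)) (spec x1 i)" using bc x1s by simp
  have m2: "spec_less (spec x2 (?j + 1)) (spec x2 ?j)" using ab x2s by simp
  define y where "y = s_node i x1"
  note y = descend[OF x1(1) i' m1, folded y_def] and y2 = descend[OF x2(1) j m2]
  have y_eq: "s_node ?j x2 = y"
  proof (rule node_eqI[OF y2(1) y(1)])
    fix k assume k: "1 \<le> k" "k \<le> n"
    have "transpose ?j (?j + 1) (transpose i (i + 1) (transpose ?j (?j + 1) k)) =
        transpose i (i + 1) (transpose ?j (?j + 1) (transpose i (i + 1) k))"
      by (auto simp: transpose_def)
    then show "spec (s_node ?j x2) k = spec y k"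
      unfolding y_def using spec_s_node[OF x2(1) j k] spec_s_node[OF x1(1) i' k] tr k i' j
      by (simp only: t1 t2 s1 s2)
  qed
  have o1: "(x1, w) \<in> node_order" and o2: "(x2, w) \<in> node_order"
    using trans_node_order x1(2) x2(2) u1(2) u2(2) by blast+
  obtain R where R: "jack_at \<nu> (Some y) R"
    using IH[OF y(1)] trans_node_order[OF y(2) o1] by blast
  have "jack_at \<nu> (Some u1) (step_op ?j (step_coeff u1 ?j) (step_op i (step_coeff x1 i) R))"
    by (rule x1(3)[OF y(3)[OF R]])
  then have 1: "P1 = step_op ?j (step_coeff u1 ?j) (step_op i (step_coeff x1 i) R)"
    using IH[OF u1] P1 unfolding u1_def by blast
  have "jack_at \<nu> (Some u2) (step_op i (step_coeff u2 i) (step_op ?j (step_coeff x2 ?j) R))"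
    by (rule x2(3)[OF y2(3)[unfolded y_eq, OF R]])
  then have 2: "P2 = step_op i (step_coeff u2 i) (step_op ?j (step_coeff x2 ?j) R)"
    using IH[OF u2] P2 unfolding u2_def by blast
  define A B C where "A = spec_val a" and "B = spec_val b" and "C = spec_val c"
  have co: "step_coeff w i = 1 / (A - B)" "step_coeff w ?j = 1 / (B - C)"
    "step_coeff u1 ?j = 1 / (A - C)" "step_coeff x1 i = 1 / (B - C)"
    "step_coeff u2 i = 1 / (A - C)" "step_coeff x2 ?j = 1 / (A - B)"
    using u1s u2s x1s x2s by (simp_all add: step_coeff_def A_def B_def C_def a_def b_def c_def)
  have ne: "A \<noteq> B" "B \<noteq> C" "A \<noteq> C"
    using spec_less_val[OF ab] spec_less_val[OF bc] spec_less_val[OF ac] by (auto simp: A_def B_def C_def)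
  have "R \<in> rst_module \<nu>" using jack_at_valid[OF R] by blast
  \<comment> \<open>This is (A - B) + (B - C) = A - C in the form that \<open>yang_baxter\<close>
    requires.\<close>
  moreover have "1 / (B - C) * (1 / (A - B)) = 1 / (A - C) * (1 / (B - C) + 1 / (A - B))"
    using ne by (simp add: divide_simps)
  ultimately show ?thesis unfolding 1 2 co by (intro yang_baxter[OF part _ i])
qed

text \<open>For i + 1 < n the places i and i + 1 come from i + 1 and i + 2 before \<Psi>. For i = n
  - 1 the raised entry is involved, and one has to go back through a second \<Psi>, to where the two
  places were 1 and 2.\<close>

lemma diamond_psi:
  assumes w: "valid (psi_node u)" and u: "valid u" and n: "1 \<le> n"
    and IH: "\<And>u'. valid u' \<Longrightarrow> (u', psi_node u) \<in> node_order \<Longrightarrow> \<exists>!P. jack_at \<nu> (Some u') P"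
    and i: "1 \<le> i" "i < n"
    and li: "spec_less (spec (psi_node u) (i + 1)) (spec (psi_node u) i)"
    and P1: "jack_at \<nu> (Some u) P1" and P2: "jack_at \<nu> (Some (s_node i (psi_node u))) P2"
  shows "psi_op n P1 = step_op i (step_coeff (psi_node u) i) P2"
proof -
  define w where "w = psi_node u"
  define u2 where "u2 = s_node i w"
  note w = w[folded w_def] and li = li[folded w_def] and IH = IH[folded w_def]
    and P2 = P2[folded w_def, folded u2_def]
  note u2 = descend(1,2)[OF w i li, folded u2_def]
  have uw: "(u, w) \<in> node_order" unfolding w_def by (rule psi_node_increases[OF u n])
  note sw = spec_psi_node[OF u, folded w_def]
  note s2 = spec_s_node[OF w i, folded u2_def]
  show ?thesis
  proof (cases "Suc i < n")
    case True
    have l1: "spec_less (spec u (Suc i + 1)) (spec u (Suc i))"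
      using li True i by (simp add: sw)
    define x where "x = s_node (Suc i) u"
    have j: "1 \<le> Suc i" "Suc i < n" using True by auto
    note x = descend[OF u j l1, folded x_def]
    note sx = spec_s_node[OF u j, folded x_def]
    have x_eq: "psi_node x = u2"
    proof (rule node_eqI[OF valid_psi_node[OF x(1) n] u2(1)])
      fix k assume k: "1 \<le> k" "k \<le> n"
      then have t: "1 \<le> transpose i (i + 1) k" "transpose i (i + 1) k \<le> n"
        using i by (auto simp: transpose_def)
      show "spec (psi_node x) k = spec u2 k"
        using k t True i spec_psi_node[OF x(1) k] s2[OF k] sw[OF t] n
        by (auto simp: sx transpose_def)
    qed
    obtain R where R: "jack_at \<nu> (Some x) R"
      using IH[OF x(1)] trans_node_order[OF x(2) uw] by blast
    have 1: "P1 = step_op (Suc i) (step_coeff u (Suc i)) R"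
      using IH[OF u uw] P1 x(3)[OF R] by blast
    have 2: "P2 = psi_op n R"
      using IH[OF u2] P2 jack_psi[OF x(1) n R] unfolding x_eq by blast
    have co: "step_coeff u (Suc i) = step_coeff w i"
      using True i by (simp add: step_coeff_def sw)
    have "R \<in> rst_module \<nu>" using jack_at_valid[OF R] by blast
    then show ?thesis unfolding 1 2 co w_def[symmetric] using i True
      by (intro psi_op_step_op[OF part])
  next
    case False
    then have ni: "n = Suc i" using i by simp
    have n2: "2 \<le> n" using i ni by simp
    \<comment> \<open>Place n of w holds a raised entry, hence at least 1, and by \<open>li\<close>
      place n - 1 of w, which is place n of u, is no smaller. So u is itself an image under
      \<Psi>.\<close>
    have "fst (spec u n) \<ge> 1"
    proof -
      have "spec w n = raise (spec u 1)" "spec w i = spec u n" using sw[of n] sw[of i] ni i by auto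
      then show ?thesis using li ni by (auto simp: spec_less_def raise_def)
    qed
    then obtain u0 where u0: "valid u0" and u0u: "psi_node u0 = u"
      using psi_node_surj[OF u n] by auto
    have ou0: "(u0, u) \<in> node_order" using psi_node_increases[OF u0 n] u0u by simp
    have su: "spec u k = (if k = n then raise (spec u0 1) else spec u0 (k + 1))"
      if "1 \<le> k" "k \<le> n" for k
      using spec_psi_node[OF u0 that] u0u by simp
    have wi: "spec w i = raise (spec u0 1)" "spec w (Suc i) = raise (spec u0 2)"
      using sw[of i] sw[of n] su[of n] su[of 1] ni i by (auto simp: numeral_2_eq_2)
    have l1: "spec_less (spec u0 (1 + 1)) (spec u0 1)"
      using li wi by (simp add: numeral_2_eq_2)
    define x where "x = s_node 1 u0"
    have one: "1 \<le> (1::nat)" "1 < n" using n2 by auto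
    note x = descend[OF u0 one l1, folded x_def]
    note sx = spec_s_node[OF u0 one, folded x_def]
    have vx: "valid (psi_node x)" by (rule valid_psi_node[OF x(1) n])
    have x_eq: "psi_node (psi_node x) = u2"
    proof (rule node_eqI[OF valid_psi_node[OF vx n] u2(1)])
      fix k assume k: "1 \<le> k" "k \<le> n"
      consider "k < i" | "k = i" | "k = n" using k ni by linarith
      then show "spec (psi_node (psi_node x)) k = spec u2 k"
      proof cases
        case 1
        then have "spec (psi_node (psi_node x)) k = spec x (k + 2)"
          using k ni by (simp add: spec_psi_node[OF vx] spec_psi_node[OF x(1)])
        also have "\<dots> = spec u0 (k + 2)" using 1 k ni by (simp add: sx)
        also have "\<dots> = spec w k" using 1 k ni by (simp add: sw su)
        also have "\<dots> = spec u2 k" using 1 k ni by (simp add: s2)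
        finally show ?thesis .
      next
        case 2
        then have "spec (psi_node (psi_node x)) k = raise (spec x 1)"
          using k ni by (simp add: spec_psi_node[OF vx] spec_psi_node[OF x(1)])
        also have "\<dots> = raise (spec u0 2)" using n2 by (simp add: sx numeral_2_eq_2)
        also have "\<dots> = spec u2 k" using 2 k ni wi by (simp add: s2)
        finally show ?thesis .
      next
        case 3
        then have "spec (psi_node (psi_node x)) k = raise (spec x 2)"
          using k n2 by (simp add: spec_psi_node[OF vx] spec_psi_node[OF x(1)] numeral_2_eq_2)
        also have "\<dots> = raise (spec u0 1)" using n2 by (simp add: sx numeral_2_eq_2)
        also have "\<dots> = spec u2 k" using 3 k ni wi by (simp add: s2)
        finally show ?thesis .
      qed
    qed
    obtain R where R: "jack_at \<nu> (Some x) R"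
      using IH[OF x(1)] trans_node_order[OF x(2) trans_node_order[OF ou0 uw]] by blast
    have "jack_at \<nu> (Some u) (psi_op n (step_op 1 (step_coeff u0 1) R))"
      using jack_psi[OF u0 n x(3)[OF R]] u0u by simp
    then have 1: "P1 = psi_op n (step_op 1 (step_coeff u0 1) R)"
      using IH[OF u uw] P1 by blast
    have 2: "P2 = psi_op n (psi_op n R)"
      using IH[OF u2] P2 jack_psi[OF vx n jack_psi[OF x(1) n R]] unfolding x_eq by blast
    have co: "step_coeff u0 1 = step_coeff w i"
      using wi by (simp add: step_coeff_def numeral_2_eq_2)
    have "R \<in> rst_module \<nu>" using jack_at_valid[OF R] by blast
    then show ?thesis unfolding 1 2 co w_def[symmetric]
      using psi_op_psi_op_step_op[OF part _ n2] ni by simp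
  qed
qed

text \<open>The last edges of two paths are compared. Minimality in \<open>node_order\<close> leaves
  the root without incoming edges, two \<Psi>-edges have the same source, and the other pairs
  complete to a diamond or coincide.\<close>

lemma jack_at_unique:
  assumes w: "valid w"
    and IH: "\<And>u. valid u \<Longrightarrow> (u, w) \<in> node_order \<Longrightarrow> \<exists>!P. jack_at \<nu> (Some u) P"
    and P: "jack_at \<nu> (Some w) P" and Q: "jack_at \<nu> (Some w) Q"
  shows "P = Q"
proof -
  have not_root: "w \<noteq> root_node" if "(u, w) \<in> node_order" "valid u" for u
    using root_node_minimal that by blast
  have psi_s: "psi_op n P' = step_op i (step_coeff w i) Q'"
    if "valid u" "1 \<le> n" "w = psi_node u" "jack_at \<nu> (Some u) P'"
      "1 \<le> i" "i < n" "spec_less (spec w (i + 1)) (spec w i)" "jack_at \<nu> (Some (s_node i w)) Q'"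
    for u i P' Q'
    using that w IH by (intro diamond_psi[of u i, folded that(3)]) auto
  show ?thesis
    using P
  proof (cases rule: jack_at_cases)
    case root
    show ?thesis using Q
    proof (cases rule: jack_at_cases)
      case 1: root
      show ?thesis using root 1 by simp
    next
      case (psi u)
      then show ?thesis using not_root[of u] psi_node_increases[of u] root by simp
    next
      case (s i)
      then show ?thesis using not_root descend[OF w] root by blast
    qed
  next
    case (psi u P')
    show ?thesis using Q
    proof (cases rule: jack_at_cases)
      case root
      then show ?thesis using not_root[of u] psi_node_increases[of u] psi by simp
    next
      case psi2: (psi u' Q')
      have "u' = u" using psi_node_inj psi psi2 by metis
      moreover have "(u, w) \<in> node_order" using psi psi_node_increases by blast
      ultimately show ?thesis using IH[of u] psi psi2 by blast
    next
      case (s i Q')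
      then show ?thesis using psi_s psi by blast
    qed
  next
    case s1: (s i P')
    show ?thesis using Q
    proof (cases rule: jack_at_cases)
      case root
      then show ?thesis using not_root descend[OF w] s1 by blast
    next
      case (psi u Q')
      then show ?thesis using psi_s[of u Q' i P'] s1 by simp
    next
      case (s j Q')
      consider "i + 2 \<le> j \<or> j + 2 \<le> i" | "j = Suc i" | "i = Suc j" | "i = j" by linarith
      then show ?thesis
      proof cases
        case 1
        then show ?thesis using diamond_far[OF w IH s1(1,2) s(1,2) 1 s1(3) s(3) s1(4) s(4)] s1 s by simp
      next
        case 2
        then show ?thesis using diamond_adjacent[OF w IH, of i P' Q'] s1 s by simp
      next
        case 3
        then show ?thesis using diamond_adjacent[OF w IH, of j Q' P'] s1 s by simp
      next
        case 4
        then show ?thesis using IH[OF descend(1,2)[OF w s(1-3)]] s1 s by blast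
      qed
    qed
  qed
qed

text \<open>A positive last entry comes from \<Psi>. A nonzero vector ending in zero has a descent,
  which comes from a swap. For the zero vector either some tableau edge comes in or the tableau is
  the root tableau.\<close>

lemma jack_at_exists:
  assumes w: "valid w"
    and IH: "\<And>u. valid u \<Longrightarrow> (u, w) \<in> node_order \<Longrightarrow> \<exists>P. jack_at \<nu> (Some u) P"
  shows "\<exists>P. jack_at \<nu> (Some w) P"
proof -
  obtain \<tau> v where wd: "w = (\<tau>, v)" by (cases w)
  have len: "length v = n" and R: "RST \<nu> \<tau>" using w by (auto simp: valid_def wd)
  interpret tableau \<nu> n \<tau> using part R by unfold_locales
  have down: ?thesis if "1 \<le> i" "i < n" "spec_less (spec w (i + 1)) (spec w i)" for i
    using descend[OF w that] IH by blast
  show ?thesis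
  proof (cases "\<exists>j. 1 \<le> j \<and> j \<le> n \<and> 0 < entry v j")
    case False
    then have zero: "entry v j = 0" if "1 \<le> j" "j \<le> n" for j using that by auto
    have v: "v = replicate n 0"
      using len zero[of "Suc _"] by (intro nth_equalityI) (auto simp: entry_def)
    have sig: "sigma v j = j" if "1 \<le> j" "j \<le> n" for j
    proof -
      have "{k \<in> {1..length v}. entry v k > entry v j \<or> entry v k = entry v j \<and> k \<le> j} = {1..j}"
        using zero that len by auto
      then show ?thesis by (simp add: sigma_def)
    qed
    show ?thesis
    proof (cases "\<exists>i. 1 \<le> i \<and> i < n \<and> CT \<tau> i - CT \<tau> (i + 1) \<le> - 2")
      case True
      then obtain i where i: "1 \<le> i" "i < n" "CT \<tau> i - CT \<tau> (i + 1) \<le> - 2" by blast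
      then show ?thesis
        using down[of i] zero sig by (simp add: spec_less_def spec_def wd)
    next
      case False
      then have "\<tau> = root_tableau \<nu>" by (intro eq_root_tableau) blast
      then show ?thesis using jack_at.root[of \<nu>] v wd sum_shape by auto
    qed
  next
    case True
    then obtain j where j: "1 \<le> j" "j \<le> n" "0 < entry v j" by blast
    show ?thesis
    proof (cases "0 < entry v n")
      case True
      have n: "1 \<le> n" using j by simp
      obtain u where "valid u" "psi_node u = w"
        using psi_node_surj[OF w n] True by (auto simp: spec_def wd)
      then show ?thesis using IH[of u] psi_node_increases[of u] jack_psi[of u] n by blast
    next
      case False
      have "\<exists>i. 1 \<le> i \<and> i < n \<and> entry v (i + 1) < entry v i"
      proof (rule ccontr)
        assume "\<not> ?thesis"
        then have mono: "entry v i \<le> entry v (i + 1)" if "1 \<le> i" "i < n" for i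
          using that by (metis not_less)
        have "entry v j \<le> entry v (j + k)" if "j + k \<le> n" for k
          using that
        proof (induction k)
          case (Suc k)
          then show ?case using mono[of "j + k"] j by simp
        qed simp
        from this[of "n - j"] show False using j False by simp
      qed
      then show ?thesis using down by (auto simp: spec_less_def spec_def wd)
    qed
  qed
qed

theorem jack_at_ex1: "valid w \<Longrightarrow> \<exists>!P. jack_at \<nu> (Some w) P"
proof (induction w rule: wf_induct_rule[OF wf_node_order])
  case (1 w)
  then show ?case using jack_at_exists[of w] jack_at_unique[of w] by blast
qed

lemma J_equality:
  assumes "jack_at \<nu> (Some (\<tau>, v)) P"
  shows "J \<nu> v \<tau> = P"
  unfolding J_def using jack_at_ex1[of "(\<tau>, v)"] jack_at_valid[OF assms] assms
  by (intro the1_equality) auto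

text \<open>Over the zero vector only tableau edges occur. The scalar of the edge cancels the
  diagonal coefficient 1/d of s_i, and since d is at least 2 the other coefficient is 1, so the
  value stays a single basis vector.\<close>

lemma jack_at_zero:
  assumes "jack_at \<nu> wo P" "wo = Some (\<tau>, replicate n 0)"
  shows "P = Poly_Mapping.single \<tau> 1"
  using assms
proof (induction "(\<tau>, replicate n 0 :: nat list)" arbitrary: wo \<tau> P rule: wf_induct_rule[OF wf_node_order])
  case (1 \<tau>)
  let ?w = "(\<tau>, replicate n 0)"
  have w: "valid ?w" using jack_at_valid 1 by blast
  have z: "entry (replicate n 0) k = 0" if "1 \<le> k" "k \<le> n" for k
    using that by (auto simp: entry_def)
  from 1(2)[unfolded 1(3)] show ?case
  proof (cases rule: jack_at_cases)
    case root
    then show ?thesis by (simp add: root_node_def)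
  next
    case (psi u P')
    then have "spec ?w n = raise (spec u 1)" using spec_psi_node[of u n] by simp
    then show ?thesis using z[of n] psi(2) by (simp add: spec_def raise_def)
  next
    case (s i P')
    define a where "a = sigma (replicate n 0 :: nat list) i"
    have eq: "entry (replicate n 0) i = entry (replicate n 0) (i + 1)" using z s by simp
    have a1: "sigma (replicate n 0) (i + 1) = a + 1"
      unfolding a_def using s eq by (intro sigma_Suc) auto
    have ai: "a = i"
    proof -
      have "{k \<in> {1..length (replicate n 0 :: nat list)}. entry (replicate n 0) k > entry (replicate n 0) i \<or>
          entry (replicate n 0) k = entry (replicate n 0) i \<and> k \<le> i} = {1..i}"
        using z s by auto
      then show ?thesis by (simp add: sigma_def a_def)
    qed
    have u: "s_node i ?w = (interchange i \<tau>, replicate n 0)"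
      using eq ai by (simp add: s_node_def a_def)
    have "P' = Poly_Mapping.single (interchange i \<tau>) 1"
      using 1(1)[OF _ s(4) ] descend(2)[OF w s(1-3)] u by simp
    moreover define d where "d = CT \<tau> (i + 1) - CT \<tau> i"
    have d: "d \<ge> 2" using s(3) a1 ai eq unfolding d_def a_def
      by (simp add: spec_less_def spec_def)
    have ax: "axial i (interchange i \<tau>) = 1 / rat_of_int d"
      by (simp add: axial_def d_def)
    have "off_coeff (1 / rat_of_int d) = 1"
    proof -
      have "rat_of_int d \<ge> 2" using d by linarith
      then show ?thesis by (simp add: off_coeff_def field_simps)
    qed
    moreover have "step_coeff ?w i = - of_rat (1 / rat_of_int d)"
    proof -
      have "step_coeff ?w i = 1 / of_int (CT \<tau> i - CT \<tau> (i + 1))"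
        using eq a1 ai by (simp add: step_coeff_def spec_val_def spec_def a_def)
      also have "CT \<tau> i - CT \<tau> (i + 1) = - d" by (simp add: d_def)
      finally show ?thesis by (simp add: of_rat_divide)
    qed
    ultimately show ?thesis
      using s(5) ax by (simp add: step_op_def s_op_single Const_uminus flip: single_add)
  qed
qed

end

subsection \<open>Restriction\<close>

lemma entry_append: "1 \<le> i \<Longrightarrow> i \<le> length v \<Longrightarrow> entry (v @ u) i = entry v i"
  by (auto simp: entry_def nth_append)

text \<open>The new zeros are smallest and stand rightmost, so they precede none of the old
  positions.\<close>

lemma sigma_append_zeros:
  assumes "1 \<le> i" "i \<le> length v"
  shows "sigma (v @ replicate k 0) i = sigma v i"
proof -
  have zero: "entry (v @ replicate k 0) j = 0" if "length v < j" "j \<le> length v + k" for j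
    using that by (auto simp: entry_def nth_append)
  have "{j \<in> {1..length (v @ replicate k 0)}. entry (v @ replicate k 0) j > entry v i \<or>
      entry (v @ replicate k 0) j = entry v i \<and> j \<le> i} =
    {j \<in> {1..length v}. entry v j > entry v i \<or> entry v j = entry v i \<and> j \<le> i}"
  proof (rule Collect_cong)
    fix j
    show "j \<in> {1..length (v @ replicate k 0)} \<and> (entry (v @ replicate k 0) j > entry v i \<or>
        entry (v @ replicate k 0) j = entry v i \<and> j \<le> i) \<longleftrightarrow>
      j \<in> {1..length v} \<and> (entry v j > entry v i \<or> entry v j = entry v i \<and> j \<le> i)"
    proof (cases "j \<le> length v")
      case True
      then show ?thesis by (cases "1 \<le> j") (simp_all add: entry_append)
    next
      case False
      then show ?thesis using zero[of j] assms by auto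
    qed
  qed
  then show ?thesis using assms by (simp add: sigma_def entry_append)
qed

lemma swap_vec_append:
  assumes "1 \<le> i" "i < length v"
  shows "swap_vec i (v @ u) = swap_vec i v @ u"
proof -
  have "i - 1 < length v" using assms by simp
  then show ?thesis using assms by (simp add: swap_vec_def entry_append list_update_append)
qed

lemma swap_vec_middle: "swap_vec (Suc (length xs)) (xs @ x # y # zs) = xs @ y # x # zs"
  by (simp add: swap_vec_def entry_def nth_append list_update_append)

section \<open>Terms killed by setting the upper variables to zero\<close>

definition vanishes_above :: "nat \<Rightarrow> pmodule \<Rightarrow> bool" where
  "vanishes_above p E \<longleftrightarrow> (\<forall>\<tau>. restrict_poly p (Poly_Mapping.lookup E \<tau>) = 0)"

lemma vanishes_above_0 [simp]: "vanishes_above p 0"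
  and vanishes_above_add: "vanishes_above p E \<Longrightarrow> vanishes_above p F \<Longrightarrow> vanishes_above p (E + F)"
  and vanishes_above_smul: "vanishes_above p E \<Longrightarrow> vanishes_above p (smul f E)"
  and vanishes_above_Var: "p < q \<Longrightarrow> vanishes_above p (smul (Var q) R)"
  by (simp_all add: vanishes_above_def lookup_add restrict_poly_add restrict_poly_mult restrict_poly_Var)

lemma vanishes_above_single: "restrict_poly p f = 0 \<Longrightarrow> vanishes_above p (Poly_Mapping.single \<tau> f)"
  by (simp add: vanishes_above_def lookup_single when_def)

lemma vanishes_above_sum:
  "(\<And>x. x \<in> A \<Longrightarrow> vanishes_above p (F x)) \<Longrightarrow> vanishes_above p (sum F A)"
  by (induction A rule: infinite_finite_induct) (auto intro: vanishes_above_add)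

lemma vanishes_above_mono:
  assumes "vanishes_above q E" "p \<le> q"
  shows "vanishes_above p E"
  using assms restrict_poly_restrict_poly[OF assms(2)] unfolding vanishes_above_def
  by (metis restrict_poly_0)

lemma vanishes_above_s_op:
  assumes "vanishes_above p E" "i < p"
  shows "vanishes_above p (s_op i E)"
  unfolding s_op_def
proof (rule vanishes_above_sum)
  fix \<tau>
  have "restrict_poly p (s_poly i (Poly_Mapping.lookup E \<tau>)) = 0"
    using assms by (simp add: restrict_poly_s_poly vanishes_above_def)
  then show "vanishes_above p (tensor (s_poly i (Poly_Mapping.lookup E \<tau>)) (s_tab i \<tau>))"
    unfolding s_tab_eq tensor_add_right tensor_single
    by (intro vanishes_above_add vanishes_above_single) (simp_all add: restrict_poly_mult)
qed

lemma restrict_mod_vanishes: "vanishes_above M E \<Longrightarrow> restrict_mod M E = 0"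
  by (simp add: restrict_mod_def vanishes_above_def)

text \<open>Deleting boxes shifts all contents equally, so the axial coefficient is unchanged, and
  it commutes with the interchange even when that leaves the RSTs.\<close>

lemma restrict_mod_s_op:
  assumes part: "is_partition \<nu> n" and P: "P \<in> rst_module \<nu>" and i: "1 \<le> i" "i < M" and M: "M \<le> n"
  shows "restrict_mod M (s_op i P) = s_op i (restrict_mod M P)"
  using P
proof (induction P rule: rst_module_induct)
  case (single \<tau> f)
  interpret tableau \<nu> n \<tau> using part single by unfold_locales
  obtain d where d: "\<And>j. 1 \<le> j \<Longrightarrow> j \<le> M \<Longrightarrow> CT (restrict_tab M \<tau>) j = CT \<tau> j - d"
    using CT_restrict_tab[OF M] by blast
  have "axial i (restrict_tab M \<tau>) = axial i \<tau>" using d i by (simp add: axial_def)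
  then show ?case
    using i by (simp add: s_op_single restrict_mod_add restrict_poly_mult restrict_poly_s_poly
        restrict_tab_interchange)
qed (simp_all add: s_op_add restrict_mod_add)

lemma restrict_mod_fold:
  assumes part: "is_partition \<nu> n" and P: "P \<in> rst_module \<nu>" and M: "M \<le> n"
    and ks: "\<And>k. k \<in> set ks \<Longrightarrow> 1 \<le> k \<and> k < M"
  shows "restrict_mod M (fold s_op ks P) = fold s_op ks (restrict_mod M P)"
  using P ks
proof (induction ks arbitrary: P)
  case (Cons k ks)
  then have k: "1 \<le> k" "k < M" by auto
  have "s_op k P \<in> rst_module \<nu>" 
    by (rule rst_module_s_op[OF part Cons.prems(1) k(1)]) (use k M in linarith)
  then show ?case using Cons restrict_mod_s_op[OF part Cons.prems(1) k M] by simp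
qed simp

context jack_graph
begin

text \<open>After applying \<open>\<Psi>\<close> for \<open>n\<close>, moving the last entry of the vector down to position \<open>p\<close>
  undoes the factors \<open>s\<^sub>p, \<dots>, s\<^sub>n\<^sub>-\<^sub>1\<close> of \<open>\<theta>\<close> up to terms that vanish for
  \<open>x\<^sub>p\<^sub>+\<^sub>1 = \<dots> = x\<^sub>n = 0\<close>. Hence \<open>\<Psi>\<close> for \<open>n\<close> restricts to \<open>\<Psi>\<close> for \<open>M\<close>.\<close>

lemma psi_chain:
  assumes P: "jack_at \<nu> (Some (\<rho>, x # xs @ replicate (n - M) 0)) P" and len: "length xs + 1 = M"
    and M: "M \<le> n" and k: "k \<le> n - M"
  shows "\<exists>E. vanishes_above (n - k) E \<and> jack_at \<nu>
    (Some (\<rho>, xs @ replicate (n - M - k) 0 @ (x + 1) # replicate k 0))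
    (smul (Var (n - k)) (fold s_op [1..<n - k] P) + E)"
  using k
proof (induction k)
  case 0
  have "jack_at \<nu> (Some (psi_node (\<rho>, x # xs @ replicate (n - M) 0))) (psi_op n P)"
    using jack_at_valid[OF P] P len M by (intro jack_psi) auto
  then have "jack_at \<nu> (Some (\<rho>, xs @ replicate (n - M - 0) 0 @ (x + 1) # replicate 0 0))
    (smul (Var (n - 0)) (fold s_op [1..<n - 0] P) + 0)"
    by (simp add: psi_node_def psi_vec_def psi_op_def)
  then show ?case using vanishes_above_0 by blast
next
  case (Suc k)
  let ?u = "xs @ replicate (n - M - k) 0 @ (x + 1) # replicate k 0"
  obtain E where E: "vanishes_above (n - k) E"
    and Q: "jack_at \<nu> (Some (\<rho>, ?u)) (smul (Var (n - k)) (fold s_op [1..<n - k] P) + E)"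
    using Suc by auto
  let ?Q = "smul (Var (n - k)) (fold s_op [1..<n - k] P) + E"
  define i where "i = n - Suc k"
  have i: "1 \<le> i" "i < n" and ni: "n - k = Suc i" and Mi: "M \<le> i"
    using Suc.prems len M by (auto simp: i_def)
  let ?ys = "xs @ replicate (n - M - Suc k) 0"
  have "n - M - k = Suc (n - M - Suc k)" using Suc.prems by simp
  then have u: "?u = ?ys @ 0 # (x + 1) # replicate k 0"
    by (simp add: replicate_append_same flip: replicate_Suc)
  have ylen: "Suc (length ?ys) = i" using len Suc.prems M by (simp add: i_def)
  have "edge \<nu> (Some (\<rho>, ?u)) (S i) (Some (\<rho>, swap_vec i ?u))"
  proof (rule edge.swap_edge)
    show "i < length ?u" using ylen unfolding u by simp
    show "entry ?u i < entry ?u (i + 1)"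
      unfolding u ylen[symmetric] by (simp add: entry_def nth_append)
  qed (rule i)
  moreover have "swap_vec i ?u = xs @ replicate (n - M - Suc k) 0 @ (x + 1) # replicate (Suc k) 0"
    unfolding u ylen[symmetric] swap_vec_middle by simp
  ultimately obtain c where jack: "jack_at \<nu>
      (Some (\<rho>, xs @ replicate (n - M - Suc k) 0 @ (x + 1) # replicate (Suc k) 0))
      (s_op i ?Q + smul (Const c) ?Q)"
    using jack_at.S_step[OF Q] by metis
  have "fold s_op [1..<i] P \<in> rst_module \<nu>"
    using jack_at_valid[OF P] i by (intro rst_module_fold[OF part]) auto
  \<comment> \<open>The last factor of \<open>fold s_op [1..<n - k]\<close> is s_i, which is
    cancelled; at the same time x_(i+1) becomes x_i.\<close>
  then have "s_op i (fold s_op [1..<n - k] P) = fold s_op [1..<i] P"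
    using s_op_involution[OF part _ i] i unfolding ni by simp
  then have "s_op i ?Q + smul (Const c) ?Q =
      smul (Var i) (fold s_op [1..<i] P) + (s_op i E + smul (Const c) ?Q)"
    unfolding ni by (simp add: s_op_add s_op_smul)
  \<comment> \<open>One part of \<open>?Q\<close> contains x_(i+1), the other is E. As E vanishes
    above i + 1, so does its image under s_i, and vanishing above i is weaker.\<close>
  moreover have "vanishes_above i (s_op i E + smul (Const c) ?Q)"
    using E unfolding ni
    by (intro vanishes_above_add vanishes_above_smul vanishes_above_Var
        vanishes_above_mono[of "Suc i" _ i] vanishes_above_s_op) auto
  ultimately show ?case using jack unfolding i_def by metis
qed

end

text \<open>The induction runs over the graph of \<mu>, while \<rho> ranges over all lifts of the
  tableau: a tableau edge changes \<rho> together with its restriction.\<close>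

theorem restrict_jack:
  assumes part: "is_partition lam N" and M: "M \<le> N" and g: "jack_graph \<mu> M"
    and \<rho>: "RST lam \<rho>" "restrict_tab M \<rho> = fst w"
    and P: "jack_at lam (Some (\<rho>, snd w @ replicate (N - M) 0)) P"
    and P': "jack_at \<mu> (Some w) P'"
  shows "restrict_mod M P = P'"
proof -
  interpret h: jack_graph \<mu> M by (rule g)
  interpret g: jack_graph lam N using part \<rho>(1) by unfold_locales auto
  let ?z = "replicate (N - M) (0 :: nat)"
  show ?thesis
    using \<rho> P P'
  proof (induction w arbitrary: \<rho> P P' rule: wf_induct_rule[OF h.wf_node_order])
    case (1 w)
    have w: "h.valid w" using h.jack_at_valid[OF 1(5)] by blast
    then have len: "length (snd w) = M" by (simp add: h.valid_def)
    interpret tableau lam N \<rho> using part 1(2) by unfold_locales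
    define W where "W = (\<rho>, snd w @ ?z)"
    have W: "g.valid W" using g.jack_at_valid[OF 1(4)] by (simp add: W_def)
    \<comment> \<open>From here on P may be computed along any path of the larger graph.\<close>
    have unique: "P = Q" if "jack_at lam (Some W) Q" for Q
      using g.jack_at_ex1[OF W] 1(4) that unfolding W_def by blast
    from 1(5) show ?case
    proof (cases rule: h.jack_at_cases)
      case root
      \<comment> \<open>The lifted vertex need not be the root, but its vector is zero, so
        \<open>jack_at_zero\<close> supplies the value.\<close>
      have "jack_at lam (Some (\<rho>, replicate N 0)) P"
        using 1(4) root M by (simp add: h.root_node_def flip: replicate_add)
      then have "P = Poly_Mapping.single \<rho> 1" using g.jack_at_zero by blast
      then show ?thesis using 1(3) root by (simp add: h.root_node_def)
    next
      case (psi u Q')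
      have lu: "length (snd u) = M" using psi(1) by (simp add: h.valid_def)
      then obtain x xs where xs: "snd u = x # xs" using psi(2) by (cases "snd u") auto
      have "g.valid (\<rho>, x # xs @ ?z)" using 1(2) lu M by (simp add: g.valid_def xs)
      then obtain Q where Q: "jack_at lam (Some (\<rho>, x # xs @ ?z)) Q" using g.jack_at_ex1 by blast
      have Qm: "Q \<in> rst_module lam" using g.jack_at_valid[OF Q] by blast
      have "(u, w) \<in> h.node_order" using h.psi_node_increases psi by blast
      then have rQ: "restrict_mod M Q = Q'"
        using 1(1)[of u \<rho> Q Q'] 1(2,3) Q psi xs by (simp add: psi_node_def)
      have NM: "N - (N - M) = M" using M by simp
      obtain E where E: "vanishes_above M E" and
        J: "jack_at lam (Some (\<rho>, xs @ (x + 1) # ?z)) (smul (Var M) (fold s_op [1..<M] Q) + E)"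
        using g.psi_chain[OF Q, of "N - M"] lu M xs NM by auto
      have "W = (\<rho>, xs @ (x + 1) # ?z)" using psi(3) xs by (simp add: W_def psi_node_def psi_vec_def)
      then have "P = smul (Var M) (fold s_op [1..<M] Q) + E" using unique J by simp
      moreover have "restrict_mod M (fold s_op [1..<M] Q) = fold s_op [1..<M] Q'"
        unfolding rQ[symmetric] by (rule restrict_mod_fold[OF part Qm M]) auto
      ultimately show ?thesis
        using psi(5) restrict_mod_vanishes[OF E]
        by (simp add: restrict_mod_add restrict_mod_smul restrict_poly_Var psi_op_def)
    next
      case (s i Q')
      obtain d where d: "\<And>j. 1 \<le> j \<Longrightarrow> j \<le> M \<Longrightarrow> CT (restrict_tab M \<rho>) j = CT \<rho> j - d"
        using CT_restrict_tab[OF M] by blast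
      \<comment> \<open>The shift d of the second component cancels in \<open>spec_less\<close> and
        in the scalar of the edge, so the s_i-edge lifts with the same coefficient.\<close>
      have spec: "spec W k = (fst (spec w k), snd (spec w k) + d)" if "1 \<le> k" "k \<le> M" for k
        using that d[of "sigma (snd w) k"] sigma_range[of k "snd w"] len 1(3)
        by (simp add: spec_def W_def entry_append sigma_append_zeros)
      have i: "1 \<le> i" "i < N" using s M by auto
      have less: "spec_less (spec W (i + 1)) (spec W i)"
        using s(1-3) by (simp add: spec spec_less_def)
      have co: "g.step_coeff W i = h.step_coeff w i"
        using s(1,2) by (simp add: g.step_coeff_def h.step_coeff_def spec spec_val_def)
      note U = g.descend[OF W i less]
      obtain Q where Q: "jack_at lam (Some (s_node i W)) Q" using g.jack_at_ex1[OF U(1)] by blast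
      have Qm: "Q \<in> rst_module lam" using g.jack_at_valid[OF Q] by blast
      have e: "entry (snd w @ ?z) i = entry (snd w) i" "entry (snd w @ ?z) (i + 1) = entry (snd w) (i + 1)"
        "sigma (snd w @ ?z) i = sigma (snd w) i"
        using s len by (simp_all add: entry_append sigma_append_zeros)
      \<comment> \<open>In a tie the rank of i + 1 is one larger and still at most M, so both
        interchanged entries survive the restriction.\<close>
      have sl: "sigma (snd w) i < M" if "entry (snd w) i = entry (snd w) (i + 1)"
        using sigma_Suc[OF s(1) _ that] sigma_range[of "i + 1" "snd w"] s len by auto
      have U_eq: "s_node i W = (fst (s_node i W), snd (s_node i w) @ ?z)"
        using e s len by (simp add: s_node_def W_def swap_vec_append)
      moreover have "restrict_tab M (fst (s_node i W)) = fst (s_node i w)"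
        using e sl 1(3) by (simp add: s_node_def W_def restrict_tab_interchange)
      moreover have "RST lam (fst (s_node i W))" using U(1) by (simp add: g.valid_def)
      moreover have "(s_node i w, w) \<in> h.node_order" by (rule h.descend(2)[OF w s(1-3)])
      ultimately have rQ: "restrict_mod M Q = Q'"
        using 1(1)[of "s_node i w" "fst (s_node i W)" Q Q'] Q s(4) by simp
      have "P = step_op i (h.step_coeff w i) Q" using unique[OF U(3)[OF Q]] co by simp
      then show ?thesis
        using s(5) rQ restrict_mod_s_op[OF part Qm s(1,2) M]
        by (simp add: step_op_def restrict_mod_add restrict_mod_smul)
    qed
  qed
qed

theorem theorem6p9:
  fixes lam :: "nat list" and N M :: nat and \<tau> :: filling
  assumes "is_partition lam N"
    and "M < N"
    and "RST lam \<tau>"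
    and "property_R M \<tau>"
  shows "\<exists>\<mu>. is_partition \<mu> M \<and> RST \<mu> (restrict_tab M \<tau>) \<and>
    (\<forall>v :: nat list. length v = M \<longrightarrow>
      restrict_mod M (J lam (v @ replicate (N - M) 0) \<tau>) = J \<mu> v (restrict_tab M \<tau>))"
proof -
  interpret tableau lam N \<tau> using assms by unfold_locales
  obtain \<mu> where \<mu>: "is_partition \<mu> M" "dom (restrict_tab M \<tau>) = diagram \<mu>"
    using assms(4) by (auto simp: property_R_def)
  have R: "RST \<mu> (restrict_tab M \<tau>)" using assms(2) \<mu> by (intro RST_restrict_tab) auto
  interpret h: jack_graph \<mu> M using \<mu>(1) R by unfold_locales auto
  interpret g: jack_graph lam N using assms by unfold_locales auto
  have "restrict_mod M (J lam (v @ replicate (N - M) 0) \<tau>) = J \<mu> v (restrict_tab M \<tau>)"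
    if len: "length v = M" for v
  proof -
    have "g.valid (\<tau>, v @ replicate (N - M) 0)" "h.valid (restrict_tab M \<tau>, v)"
      using assms R len by (auto simp: g.valid_def h.valid_def)
    then obtain P P' where P: "jack_at lam (Some (\<tau>, v @ replicate (N - M) 0)) P"
      and P': "jack_at \<mu> (Some (restrict_tab M \<tau>, v)) P'"
      using g.jack_at_ex1 h.jack_at_ex1 by blast
    have "restrict_mod M P = P'"
      using restrict_jack[OF assms(1) _ h.jack_graph_axioms assms(3), of "(restrict_tab M \<tau>, v)"]
        assms(2) P P' by simp
    then show ?thesis using g.J_equality[OF P] h.J_equality[OF P'] by simp
  qed
  then show ?thesis using \<mu>(1) R by blast
qed

end
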